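(* Let $\circlearrowleft$ be the classical channel on the index set $\{0,1,2\}$ given by the doubly stochastic matrix $$P=\begin{pmatrix}0&1&0\\0&0&1\\1&0&0\end{pmatrix},$$ with motion reversal given by the identity on the index set; equivalently, regard $\circlearrowleft$ as the unital channel $\rho\mapsto\sum_{j,k}P_{jk}\langle k|\rho|k\rangle\,|j\rangle\langle j|$ on the system $(\mathbb C^3,\theta)$. Then $\circlearrowleft$ is a golden unit for kinematic T-violation: for every $d\ge 1$ and every unital channel $\mathcal E$ on $(\mathbb C^d,\theta)$ there exists a T-symmetric superchannel $f$ from $(\mathbb C^3,\theta)$ to $(\mathbb C^d,\theta)$ such that $f(\circlearrowleft)=\mathcal E$.
   Context: A system $A=(\mathcal H_A,\Theta_A)$ is a finite-dimensional complex Hilbert space with a fixed orthonormal computational basis, together with an antiunitary operator $\Theta_A$ (the motion-reversal operator). Here all motion-reversal operators are $\theta$, complex conjugation in the computational basis. Write $\mathrm{Ad}_O(\rho)=O\rho O^\dagger$. A channel on $A$ is a CPTP map $\mathcal B(\mathcal H_A)\to\mathcal B(\mathcal H_A)$; it is unital if it fixes $\mathbb I$. $\dagger$ on maps denotes the Hilbert–Schmidt adjoint. A deterministic superchannel $f:A\multimap B$ is a linear map from linear maps on $\mathcal B(\mathcal H_A)$ to linear maps on $\mathcal B(\mathcal H_B)$ of the form $f(\mathcal E)=\mathcal F_d\circ(\mathcal E\otimes\mathrm{id}_M)\circ\mathcal F_e$, with $M$ a finite-dimensional memory system and $\mathcal F_e:\mathcal B(\mathcal H_B)\to\mathcal B(\mathcal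 H_A\otimes\mathcal H_M)$, $\mathcal F_d:\mathcal B(\mathcal H_A\otimes\mathcal H_M)\to\mathcal B(\mathcal H_B)$ CPTP. Its adjoint is the supermap $f^\dagger(\mathcal E)=\mathcal F_e^\dagger\circ(\mathcal E\otimes\mathrm{id}_M)\circ\mathcal F_d^\dagger$ (independent of the chosen realization). Its reverse-process simulator is $$f_\Theta(\mathcal E)=\mathrm{Ad}_{\Theta_B^\dagger}\circ f^\dagger\big(\mathrm{Ad}_{\Theta_A}\circ\mathcal E\circ\mathrm{Ad}_{\Theta_A^\dagger}\big)\circ\mathrm{Ad}_{\Theta_B}.$$ A deterministic superchannel $f$ is T-symmetric if $f=f_\Theta$. *)

theory Defs
  imports "Jordan_Normal_Form.Schur_Decomposition"
begin

(* The system (C^n, theta) is represented by its dimension n, and operators on it by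
   carrier_mat n n, written in the computational basis.  Maps between operator spaces are
   functions on the type of all complex matrices, so only their values on the relevant carrier
   are meaningful; every predicate below is insensitive to the values elsewhere. *)

section \<open>Channels\<close>

definition lin_map :: "nat \<Rightarrow> nat \<Rightarrow> (complex mat \<Rightarrow> complex mat) \<Rightarrow> bool" where
  "lin_map n m F \<longleftrightarrow>
     (\<forall>X \<in> carrier_mat n n. F X \<in> carrier_mat m m) \<and>
     (\<forall>X \<in> carrier_mat n n. \<forall>Y \<in> carrier_mat n n. F (X + Y) = F X + F Y) \<and>
     (\<forall>c. \<forall>X \<in> carrier_mat n n. F (c \<cdot>\<^sub>m X) = c \<cdot>\<^sub>m F X)"

definition mtrace :: "complex mat \<Rightarrow> complex" where
  "mtrace X = (\<Sum>i<dim_row X. X $$ (i, i))"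

(* X >= 0: all <v|X|v> are real and nonnegative; over the complex numbers this forces
   X to be Hermitian. *)
definition psd :: "nat \<Rightarrow> complex mat \<Rightarrow> bool" where
  "psd n X \<longleftrightarrow> X \<in> carrier_mat n n \<and>
     (\<forall>v \<in> carrier_vec n. Im ((X *\<^sub>v v) \<bullet>c v) = 0 \<and> Re ((X *\<^sub>v v) \<bullet>c v) \<ge> 0)"

(* The basis vector |i> (x) |k> of C^n (x) C^m has index i * m + k.
   mblock n m k l X is (1 (x) <k|) X (1 (x) |l>), an operator on C^n. *)
definition mblock :: "nat \<Rightarrow> nat \<Rightarrow> nat \<Rightarrow> nat \<Rightarrow> complex mat \<Rightarrow> complex mat" where
  "mblock n m k l X = mat n n (\<lambda>(i, j). X $$ (i * m + k, j * m + l))"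

definition kron :: "nat \<Rightarrow> nat \<Rightarrow> complex mat \<Rightarrow> complex mat \<Rightarrow> complex mat" where
  "kron n m A B = mat (n * m) (n * m)
     (\<lambda>(r, s). A $$ (r div m, s div m) * B $$ (r mod m, s mod m))"

(* F (x) id_M for linear F : B(C^n) -> B(C^n') and M = C^m, applied blockwise; the lemmas
   lin_map_tensor_id and tensor_id_kron below characterise it. *)
definition tensor_id ::
    "nat \<Rightarrow> nat \<Rightarrow> nat \<Rightarrow> (complex mat \<Rightarrow> complex mat) \<Rightarrow> complex mat \<Rightarrow> complex mat" where
  "tensor_id n n' m F X = mat (n' * m) (n' * m)
     (\<lambda>(r, s). F (mblock n m (r mod m) (s mod m) X) $$ (r div m, s div m))"

definition completely_positive :: "nat \<Rightarrow> nat \<Rightarrow> (complex mat \<Rightarrow> complex mat) \<Rightarrow> bool" where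
  "completely_positive n n' F \<longleftrightarrow> (\<forall>m X. psd (n * m) X \<longrightarrow> psd (n' * m) (tensor_id n n' m F X))"

definition trace_preserving :: "nat \<Rightarrow> (complex mat \<Rightarrow> complex mat) \<Rightarrow> bool" where
  "trace_preserving n F \<longleftrightarrow> (\<forall>X \<in> carrier_mat n n. mtrace (F X) = mtrace X)"

definition cptp :: "nat \<Rightarrow> nat \<Rightarrow> (complex mat \<Rightarrow> complex mat) \<Rightarrow> bool" where
  "cptp n n' F \<longleftrightarrow> lin_map n n' F \<and> completely_positive n n' F \<and> trace_preserving n F"

definition unital_channel :: "nat \<Rightarrow> (complex mat \<Rightarrow> complex mat) \<Rightarrow> bool" where
  "unital_channel n F \<longleftrightarrow> cptp n n F \<and> F (1\<^sub>m n) = 1\<^sub>m n"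

section \<open>Hilbert--Schmidt adjoint\<close>

definition hs_inner :: "complex mat \<Rightarrow> complex mat \<Rightarrow> complex" where
  "hs_inner X Y = mtrace (mat_adjoint X * Y)"

(* For linear F : B(C^n) -> B(C^n') this is F^dagger : B(C^n') -> B(C^n); existence and
   uniqueness are proved below. *)
definition hs_adjoint ::
    "nat \<Rightarrow> nat \<Rightarrow> (complex mat \<Rightarrow> complex mat) \<Rightarrow> complex mat \<Rightarrow> complex mat" where
  "hs_adjoint n n' F Y =
     (THE Z. Z \<in> carrier_mat n n \<and> (\<forall>X \<in> carrier_mat n n. hs_inner (F X) Y = hs_inner X Z))"

section \<open>Superchannels\<close>

type_synonym supermap = "(complex mat \<Rightarrow> complex mat) \<Rightarrow> complex mat \<Rightarrow> complex mat"

definition comb ::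
    "nat \<Rightarrow> nat \<Rightarrow> (complex mat \<Rightarrow> complex mat) \<Rightarrow> (complex mat \<Rightarrow> complex mat) \<Rightarrow> supermap" where
  "comb dA m Fe Fd E = Fd \<circ> tensor_id dA dA m E \<circ> Fe"

definition realizes ::
    "nat \<Rightarrow> nat \<Rightarrow> nat \<Rightarrow> (complex mat \<Rightarrow> complex mat) \<Rightarrow> (complex mat \<Rightarrow> complex mat) \<Rightarrow>
     supermap \<Rightarrow> bool" where
  "realizes dA dB m Fe Fd f \<longleftrightarrow> cptp dB (dA * m) Fe \<and> cptp (dA * m) dB Fd \<and>
     (\<forall>E. lin_map dA dA E \<longrightarrow> (\<forall>X \<in> carrier_mat dB dB. f E X = comb dA m Fe Fd E X))"

definition superchannel :: "nat \<Rightarrow> nat \<Rightarrow> supermap \<Rightarrow> bool" where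
  "superchannel dA dB f \<longleftrightarrow> (\<exists>m Fe Fd. realizes dA dB m Fe Fd f)"

definition comb_adjoint ::
    "nat \<Rightarrow> nat \<Rightarrow> nat \<Rightarrow> (complex mat \<Rightarrow> complex mat) \<Rightarrow> (complex mat \<Rightarrow> complex mat) \<Rightarrow>
     supermap" where
  "comb_adjoint dA dB m Fe Fd =
     comb dA m (hs_adjoint (dA * m) dB Fd) (hs_adjoint dB (dA * m) Fe)"

(* The choice of realization is immaterial: see superchannel_adjoint_eq. *)
definition superchannel_adjoint :: "nat \<Rightarrow> nat \<Rightarrow> supermap \<Rightarrow> supermap" where
  "superchannel_adjoint dA dB f =
     (SOME g. \<exists>m Fe Fd. realizes dA dB m Fe Fd f \<and> g = comb_adjoint dA dB m Fe Fd)"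

section \<open>Motion reversal\<close>

(* theta conjugates coordinates, so theta = theta^dagger and theta X theta^dagger is the
   entrywise conjugate of X (lemma Ad_theta_mult_vec). *)
definition theta :: "complex vec \<Rightarrow> complex vec" where
  "theta v = conjugate v"

definition Ad_theta :: "complex mat \<Rightarrow> complex mat" where
  "Ad_theta X = map_mat cnj X"

definition reverse_simulator :: "nat \<Rightarrow> nat \<Rightarrow> supermap \<Rightarrow> supermap" where
  "reverse_simulator dA dB f E =
     Ad_theta \<circ> superchannel_adjoint dA dB f (Ad_theta \<circ> E \<circ> Ad_theta) \<circ> Ad_theta"

definition T_symmetric :: "nat \<Rightarrow> nat \<Rightarrow> supermap \<Rightarrow> bool" where
  "T_symmetric dA dB f \<longleftrightarrow> superchannel dA dB f \<and>
     (\<forall>E. lin_map dA dA E \<longrightarrow>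
        (\<forall>X \<in> carrier_mat dB dB. f E X = reverse_simulator dA dB f E X))"

section \<open>Classical channels\<close>

definition classical_channel :: "nat \<Rightarrow> complex mat \<Rightarrow> complex mat \<Rightarrow> complex mat" where
  "classical_channel n P \<rho> =
     mat n n (\<lambda>(i, j). if i = j then \<Sum>k<n. P $$ (j, k) * \<rho> $$ (k, k) else 0)"

definition cyclic_matrix :: "complex mat" where
  "cyclic_matrix = mat_of_rows_list 3 [[0, 1, 0], [0, 0, 1], [1, 0, 0]]"

abbreviation circlearrow :: "complex mat \<Rightarrow> complex mat" where
  "circlearrow \<equiv> classical_channel 3 cyclic_matrix"

section \<open>Well-definedness\<close>

lemma Ad_theta_mult_vec:
  assumes "X \<in> carrier_mat n n" "v \<in> carrier_vec n"
  shows "Ad_theta X *\<^sub>v v = theta (X *\<^sub>v theta v)"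
  using assms
  by (intro eq_vecI) (auto simp: Ad_theta_def theta_def scalar_prod_def conjugate_complex_def)

lemma tensor_index_less: "i < n \<Longrightarrow> k < m \<Longrightarrow> i * m + k < n * (m :: nat)"
proof -
  assume "i < n" "k < m"
  then have "i * m + k < Suc i * m" by simp
  also have "\<dots> \<le> n * m" using \<open>i < n\<close> by (intro mult_le_mono1) simp
  finally show ?thesis .
qed

lemma tensor_div_less: "r < n * m \<Longrightarrow> r div m < (n :: nat)"
  by (simp add: less_mult_imp_div_less)

lemma tensor_mod_less: "r < n * m \<Longrightarrow> r mod m < (m :: nat)"
  by (cases "m = 0") auto

lemma sum_tensor_index:
  fixes g :: "nat \<Rightarrow> complex"
  shows "(\<Sum>r<n * m. g r) = (\<Sum>i<n. \<Sum>k<m. g (i * m + k))"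
proof -
  have "(\<Sum>r<n * m. g r) = (\<Sum>(i, k)\<in>{..<n} \<times> {..<m}. g (i * m + k))"
    by (rule sum.reindex_bij_witness[where i = "\<lambda>(i, k). i * m + k" and j = "\<lambda>r. (r div m, r mod m)"])
       (auto simp: tensor_index_less tensor_div_less tensor_mod_less)
  then show ?thesis by (simp add: sum.cartesian_product)
qed

lemma mblock_carrier [simp]: "mblock n m k l X \<in> carrier_mat n n"
  by (simp add: mblock_def)

lemma tensor_id_carrier [simp]: "tensor_id n n' m F X \<in> carrier_mat (n' * m) (n' * m)"
  by (simp add: tensor_id_def)

lemma lin_map_carrier: "lin_map n m F \<Longrightarrow> X \<in> carrier_mat n n \<Longrightarrow> F X \<in> carrier_mat m m"
  by (simp add: lin_map_def)

lemma mblock_add: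
  "X \<in> carrier_mat (n * m) (n * m) \<Longrightarrow> Y \<in> carrier_mat (n * m) (n * m) \<Longrightarrow> k < m \<Longrightarrow> l < m \<Longrightarrow>
   mblock n m k l (X + Y) = mblock n m k l X + mblock n m k l Y"
  by (intro eq_matI) (auto simp: mblock_def tensor_index_less)

lemma mblock_smult:
  "X \<in> carrier_mat (n * m) (n * m) \<Longrightarrow> k < m \<Longrightarrow> l < m \<Longrightarrow>
   mblock n m k l (c \<cdot>\<^sub>m X) = c \<cdot>\<^sub>m mblock n m k l X"
  by (intro eq_matI) (auto simp: mblock_def tensor_index_less)

lemma lin_map_tensor_id:
  assumes F: "lin_map n n' F"
  shows "lin_map (n * m) (n' * m) (tensor_id n n' m F)"
proof -
  have c: "\<And>k l X. F (mblock n m k l X) \<in> carrier_mat n' n'"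
    using F by (simp add: lin_map_def)
  have d: "\<And>k l X. dim_row (F (mblock n m k l X)) = n'" "\<And>k l X. dim_col (F (mblock n m k l X)) = n'"
    using c by auto
  have "tensor_id n n' m F (X + Y) = tensor_id n n' m F X + tensor_id n n' m F Y"
    if "X \<in> carrier_mat (n * m) (n * m)" "Y \<in> carrier_mat (n * m) (n * m)" for X Y
    using that F d
    by (intro eq_matI)
       (auto simp: tensor_id_def mblock_add tensor_mod_less tensor_div_less lin_map_def)
  moreover have "tensor_id n n' m F (a \<cdot>\<^sub>m X) = a \<cdot>\<^sub>m tensor_id n n' m F X"
    if "X \<in> carrier_mat (n * m) (n * m)" for a X
    using that F d
    by (intro eq_matI)
       (auto simp: tensor_id_def mblock_smult tensor_mod_less tensor_div_less lin_map_def)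
  ultimately show ?thesis by (simp add: lin_map_def)
qed

lemma tensor_id_kron:
  assumes F: "lin_map n n' F" and A: "A \<in> carrier_mat n n"
  shows "tensor_id n n' m F (kron n m A B) = kron n' m (F A) B"
proof (rule eq_matI)
  fix r s assume "r < dim_row (kron n' m (F A) B)" "s < dim_col (kron n' m (F A) B)"
  then have rs: "r < n' * m" "s < n' * m" by (auto simp: kron_def)
  then have "0 < m" by (cases m) auto
  have "mblock n m (r mod m) (s mod m) (kron n m A B) = B $$ (r mod m, s mod m) \<cdot>\<^sub>m A"
    using A rs \<open>0 < m\<close> by (intro eq_matI) (auto simp: mblock_def kron_def tensor_index_less tensor_mod_less)
  moreover have "F (B $$ (r mod m, s mod m) \<cdot>\<^sub>m A) = B $$ (r mod m, s mod m) \<cdot>\<^sub>m F A"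
    using F A by (simp add: lin_map_def)
  moreover have "F A \<in> carrier_mat n' n'" using F A by (simp add: lin_map_def)
  ultimately show "tensor_id n n' m F (kron n m A B) $$ (r, s) = kron n' m (F A) B $$ (r, s)"
    using rs by (auto simp: tensor_id_def kron_def tensor_div_less)
qed (auto simp: tensor_id_def kron_def)

lemma mblock_tensor_id:
  assumes "lin_map n n' F" "k < m" "l < m"
  shows "mblock n' m k l (tensor_id n n' m F X) = F (mblock n m k l X)"
proof -
  have "F (mblock n m k l X) \<in> carrier_mat n' n'" using assms by (simp add: lin_map_def)
  then show ?thesis using assms
    by (intro eq_matI) (auto simp: mblock_def[of n'] tensor_id_def tensor_index_less)
qed

lemma mat_adjoint_dim [simp]:
  "dim_row (mat_adjoint X) = dim_col X" "dim_col (mat_adjoint X) = dim_row X"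
  by (auto simp: mat_adjoint_def)

lemma mat_adjoint_index:
  "i < dim_col X \<Longrightarrow> j < dim_row X \<Longrightarrow> mat_adjoint X $$ (i, j) = cnj (X $$ (j, i))" for X :: "complex mat"
  by (simp add: mat_adjoint_def mat_of_rows_def conjugate_complex_def)

lemma hs_inner_sum:
  assumes "X \<in> carrier_mat n n" "Y \<in> carrier_mat n n"
  shows "hs_inner X Y = (\<Sum>i<n. \<Sum>j<n. cnj (X $$ (i, j)) * Y $$ (i, j))"
proof -
  have "hs_inner X Y = (\<Sum>j<n. \<Sum>i<n. cnj (X $$ (i, j)) * Y $$ (i, j))"
    using assms
    by (auto simp: hs_inner_def mtrace_def scalar_prod_def mat_adjoint_index atLeast0LessThan
        intro!: sum.cong)
  then show ?thesis by (subst sum.swap)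
qed

lemma hs_inner_cnj:
  "X \<in> carrier_mat n n \<Longrightarrow> Y \<in> carrier_mat n n \<Longrightarrow> hs_inner Y X = cnj (hs_inner X Y)"
  by (simp add: hs_inner_sum[of _ n] mult.commute)

lemma hs_inner_mblock:
  assumes "X \<in> carrier_mat (n * m) (n * m)" "Y \<in> carrier_mat (n * m) (n * m)"
  shows "hs_inner X Y = (\<Sum>k<m. \<Sum>l<m. hs_inner (mblock n m k l X) (mblock n m k l Y))"
proof -
  define h where "h i k j l = cnj (X $$ (i * m + k, j * m + l)) * Y $$ (i * m + k, j * m + l)"
    for i k j l
  have "hs_inner X Y = (\<Sum>i<n. \<Sum>k<m. \<Sum>j<n. \<Sum>l<m. h i k j l)"
    by (simp add: hs_inner_sum[OF assms] sum_tensor_index h_def)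
  also have "\<dots> = (\<Sum>k<m. \<Sum>i<n. \<Sum>j<n. \<Sum>l<m. h i k j l)" by (rule sum.swap)
  also have "\<dots> = (\<Sum>k<m. \<Sum>i<n. \<Sum>l<m. \<Sum>j<n. h i k j l)"
    by (intro sum.cong refl sum.swap)
  also have "\<dots> = (\<Sum>k<m. \<Sum>l<m. \<Sum>i<n. \<Sum>j<n. h i k j l)"
    by (intro sum.cong refl sum.swap)
  also have "\<dots> = (\<Sum>k<m. \<Sum>l<m. hs_inner (mblock n m k l X) (mblock n m k l Y))"
    by (auto simp: hs_inner_sum[of _ n] h_def mblock_def intro!: sum.cong)
  finally show ?thesis .
qed

definition mat_unit :: "nat \<Rightarrow> nat \<Rightarrow> nat \<Rightarrow> complex mat" where
  "mat_unit n i j = mat n n (\<lambda>(a, b). if a = i \<and> b = j then 1 else 0)"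

lemma mat_unit_carrier [simp]: "mat_unit n i j \<in> carrier_mat n n"
  by (simp add: mat_unit_def)

lemma hs_inner_mat_unit:
  assumes "Z \<in> carrier_mat n n" "i < n" "j < n"
  shows "hs_inner (mat_unit n i j) Z = Z $$ (i, j)"
proof -
  have "hs_inner (mat_unit n i j) Z =
      (\<Sum>a<n. \<Sum>b<n. if a = i \<and> b = j then Z $$ (a, b) else 0)"
    using assms
    by (auto simp: hs_inner_sum[of _ n] mat_unit_def intro!: sum.cong)
  also have "\<dots> = (\<Sum>a<n. if a = i then Z $$ (a, j) else 0)"
    using assms by (intro sum.cong refl) (auto simp: if_distrib sum.delta)
  finally show ?thesis using assms by simp
qed

lemma hs_inner_eqI:
  assumes "Z \<in> carrier_mat n n" "W \<in> carrier_mat n n"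
    and "\<And>X. X \<in> carrier_mat n n \<Longrightarrow> hs_inner X Z = hs_inner X W"
  shows "Z = W"
proof (rule eq_matI)
  fix i j assume "i < dim_row W" "j < dim_col W"
  then have "i < n" "j < n" using assms by auto
  then show "Z $$ (i, j) = W $$ (i, j)"
    using assms hs_inner_mat_unit[of Z n i j] hs_inner_mat_unit[of W n i j] by simp
qed (use assms in auto)

lemma linear_functional_rep:
  fixes \<phi> :: "complex mat \<Rightarrow> complex"
  assumes add: "\<And>X Y. X \<in> carrier_mat n n \<Longrightarrow> Y \<in> carrier_mat n n \<Longrightarrow> \<phi> (X + Y) = \<phi> X + \<phi> Y"
    and smult: "\<And>c X. X \<in> carrier_mat n n \<Longrightarrow> \<phi> (c \<cdot>\<^sub>m X) = c * \<phi> X"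
    and X: "X \<in> carrier_mat n n"
  shows "\<phi> X = (\<Sum>i<n. \<Sum>j<n. X $$ (i, j) * \<phi> (mat_unit n i j))"
proof -
  define R where "R S = mat n n (\<lambda>p. if p \<in> S then X $$ p else 0)" for S
  have Rc: "R S \<in> carrier_mat n n" for S by (simp add: R_def)
  have main: "\<phi> (R S) = (\<Sum>(i, j)\<in>S. X $$ (i, j) * \<phi> (mat_unit n i j))"
    if "finite S" "S \<subseteq> {..<n} \<times> {..<n}" for S
    using that
  proof (induction S rule: finite_induct)
    case empty
    have "R {} = 0 \<cdot>\<^sub>m 0\<^sub>m n n" by (intro eq_matI) (auto simp: R_def)
    then show ?case using smult[of "0\<^sub>m n n" 0] by simp
  next
    case (insert p S)
    obtain i j where p: "p = (i, j)" by (cases p)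
    have "R (insert p S) = X $$ (i, j) \<cdot>\<^sub>m mat_unit n i j + R S"
      using insert.hyps insert.prems p by (intro eq_matI) (auto simp: R_def mat_unit_def)
    then have "\<phi> (R (insert p S)) = X $$ (i, j) * \<phi> (mat_unit n i j) + \<phi> (R S)"
      using add[of "X $$ (i, j) \<cdot>\<^sub>m mat_unit n i j" "R S"] smult[of "mat_unit n i j"] Rc by simp
    then show ?case using insert p by simp
  qed
  have "X = R ({..<n} \<times> {..<n})" using X by (intro eq_matI) (auto simp: R_def)
  then show ?thesis using main[of "{..<n} \<times> {..<n}"] by (simp add: sum.cartesian_product)
qed

lemma hs_adjoint_ex1:
  assumes F: "lin_map n n' F" and Y: "Y \<in> carrier_mat n' n'"
  shows "\<exists>!Z. Z \<in> carrier_mat n n \<and> (\<forall>X \<in> carrier_mat n n. hs_inner (F X) Y = hs_inner X Z)"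
proof (rule ex_ex1I)
  define Z where "Z = mat n n (\<lambda>(i, j). hs_inner (F (mat_unit n i j)) Y)"
  have Zc: "Z \<in> carrier_mat n n" by (simp add: Z_def)
  have Fc: "F X \<in> carrier_mat n' n'" if "X \<in> carrier_mat n n" for X
    using F that by (simp add: lin_map_def)
  have "hs_inner (F X) Y = hs_inner X Z" if X: "X \<in> carrier_mat n n" for X
  proof -
    define \<phi> where "\<phi> X = cnj (hs_inner (F X) Y)" for X
    have "\<phi> (X + W) = \<phi> X + \<phi> W" if "X \<in> carrier_mat n n" "W \<in> carrier_mat n n" for X W
    proof -
      have "F (X + W) = F X + F W" using F that by (simp add: lin_map_def)
      then show ?thesis using Fc[OF that(1)] Fc[OF that(2)] Y
        by (simp add: \<phi>_def hs_inner_sum[of _ n'] distrib_right sum.distrib)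
    qed
    moreover have "\<phi> (c \<cdot>\<^sub>m X) = c * \<phi> X" if "X \<in> carrier_mat n n" for c X
    proof -
      have "F (c \<cdot>\<^sub>m X) = c \<cdot>\<^sub>m F X" using F that by (simp add: lin_map_def)
      then show ?thesis using Fc[OF that] Y
        by (simp add: \<phi>_def hs_inner_sum[of _ n'] sum_distrib_left mult.assoc)
    qed
    ultimately have "\<phi> X = (\<Sum>i<n. \<Sum>j<n. X $$ (i, j) * \<phi> (mat_unit n i j))"
      using X by (rule linear_functional_rep)
    then have "cnj (\<phi> X) = (\<Sum>i<n. \<Sum>j<n. cnj (X $$ (i, j)) * Z $$ (i, j))"
      by (simp add: \<phi>_def Z_def)
    then show ?thesis using X Zc by (simp add: \<phi>_def hs_inner_sum[of _ n])
  qed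
  then show "\<exists>Z. Z \<in> carrier_mat n n \<and> (\<forall>X \<in> carrier_mat n n. hs_inner (F X) Y = hs_inner X Z)"
    using Zc by blast
next
  fix Z W
  assume "Z \<in> carrier_mat n n \<and> (\<forall>X \<in> carrier_mat n n. hs_inner (F X) Y = hs_inner X Z)"
    and "W \<in> carrier_mat n n \<and> (\<forall>X \<in> carrier_mat n n. hs_inner (F X) Y = hs_inner X W)"
  then show "Z = W" by (intro hs_inner_eqI[of _ n]) auto
qed

lemma hs_adjoint:
  assumes "lin_map n n' F" "Y \<in> carrier_mat n' n'"
  shows hs_adjoint_carrier: "hs_adjoint n n' F Y \<in> carrier_mat n n"
    and hs_inner_hs_adjoint:
      "X \<in> carrier_mat n n \<Longrightarrow> hs_inner (F X) Y = hs_inner X (hs_adjoint n n' F Y)"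
  using theI'[OF hs_adjoint_ex1[OF assms]] by (auto simp: hs_adjoint_def)

lemma hs_adjoint_unique:
  assumes "lin_map n n' F" "Y \<in> carrier_mat n' n'" "Z \<in> carrier_mat n n"
    and "\<And>X. X \<in> carrier_mat n n \<Longrightarrow> hs_inner (F X) Y = hs_inner X Z"
  shows "hs_adjoint n n' F Y = Z"
  using assms hs_adjoint[OF assms(1,2)] by (intro hs_inner_eqI[of _ n]) auto

lemma lin_map_hs_adjoint:
  assumes F: "lin_map n n' F"
  shows "lin_map n' n (hs_adjoint n n' F)"
proof -
  have Fc: "\<And>X. X \<in> carrier_mat n n \<Longrightarrow> F X \<in> carrier_mat n' n'"
    using F by (simp add: lin_map_def)
  have i_add: "hs_inner X (Y + Z) = hs_inner X Y + hs_inner X Z"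
    if "X \<in> carrier_mat a a" "Y \<in> carrier_mat a a" "Z \<in> carrier_mat a a" for a X Y Z
    using that by (simp add: hs_inner_sum[of _ a] distrib_left sum.distrib)
  have i_smult: "hs_inner X (c \<cdot>\<^sub>m Y) = c * hs_inner X Y"
    if "X \<in> carrier_mat a a" "Y \<in> carrier_mat a a" for a c X Y
    using that by (simp add: hs_inner_sum[of _ a] sum_distrib_left mult.left_commute)
  have "hs_adjoint n n' F (Y + Z) = hs_adjoint n n' F Y + hs_adjoint n n' F Z"
    if "Y \<in> carrier_mat n' n'" "Z \<in> carrier_mat n' n'" for Y Z
    using that hs_adjoint[OF F] Fc i_add
    by (intro hs_adjoint_unique[OF F]) (simp_all add: i_add[of _ n] i_add[of _ n'])
  moreover have "hs_adjoint n n' F (c \<cdot>\<^sub>m Y) = c \<cdot>\<^sub>m hs_adjoint n n' F Y"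
    if "Y \<in> carrier_mat n' n'" for c Y
    using that hs_adjoint[OF F] Fc
    by (intro hs_adjoint_unique[OF F]) (simp_all add: i_smult[of _ n] i_smult[of _ n'])
  ultimately show ?thesis using hs_adjoint(1)[OF F] by (simp add: lin_map_def)
qed

lemma hs_inner_hs_adjoint':
  assumes "lin_map n n' F" "Y \<in> carrier_mat n' n'" "X \<in> carrier_mat n n"
  shows "hs_inner Y (F X) = hs_inner (hs_adjoint n n' F Y) X"
proof -
  have "hs_inner Y (F X) = cnj (hs_inner (F X) Y)"
    using assms by (intro hs_inner_cnj[of _ n']) (auto simp: lin_map_def)
  also have "\<dots> = cnj (hs_inner X (hs_adjoint n n' F Y))" using assms hs_inner_hs_adjoint by simp
  also have "\<dots> = hs_inner (hs_adjoint n n' F Y) X"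
    using assms hs_adjoint_carrier by (intro hs_inner_cnj[symmetric, of _ n]) auto
  finally show ?thesis .
qed

lemma hs_inner_tensor_id:
  assumes E: "lin_map n n' E"
    and X: "X \<in> carrier_mat (n * m) (n * m)" and Y: "Y \<in> carrier_mat (n' * m) (n' * m)"
  shows "hs_inner (tensor_id n n' m E X) Y = hs_inner X (tensor_id n' n m (hs_adjoint n n' E) Y)"
  using hs_inner_hs_adjoint[OF E]
  by (simp add: hs_inner_mblock[OF _ Y] hs_inner_mblock[OF X] mblock_tensor_id[OF E]
      mblock_tensor_id[OF lin_map_hs_adjoint[OF E]])

lemma hs_adjoint_hs_adjoint:
  assumes "lin_map n n' F" "X \<in> carrier_mat n n"
  shows "hs_adjoint n' n (hs_adjoint n n' F) X = F X"
  using assms hs_inner_hs_adjoint'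
  by (intro hs_adjoint_unique lin_map_hs_adjoint) (auto simp: lin_map_def)

lemma cptp_linear: "cptp n m F \<Longrightarrow> lin_map n m F"
  by (simp add: cptp_def)

lemma comb_adjoint_eq:
  assumes r: "realizes dA dB m Fe Fd f"
    and E: "lin_map dA dA E" and Y: "Y \<in> carrier_mat dB dB"
  shows "comb_adjoint dA dB m Fe Fd E Y = hs_adjoint dB dB (f (hs_adjoint dA dA E)) Y"
proof -
  let ?E' = "hs_adjoint dA dA E"
  have e: "lin_map dB (dA * m) Fe" and d: "lin_map (dA * m) dB Fd"
    using r by (auto simp: realizes_def cptp_linear)
  have E': "lin_map dA dA ?E'" by (rule lin_map_hs_adjoint[OF E])
  note T = lin_map_tensor_id[OF E, of m] and T' = lin_map_tensor_id[OF E', of m]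
  have f: "f ?E' X = Fd (tensor_id dA dA m ?E' (Fe X))" if "X \<in> carrier_mat dB dB" for X
    using r E' that by (auto simp: realizes_def comb_def)
  have "lin_map dB dB (f ?E')"
    unfolding lin_map_def
  proof (intro conjI ballI allI)
    fix X :: "complex mat" assume X: "X \<in> carrier_mat dB dB"
    note c = lin_map_carrier[OF e X]
    show "f ?E' X \<in> carrier_mat dB dB" using d by (simp add: f[OF X] lin_map_def)
    { fix c
      show "f ?E' (c \<cdot>\<^sub>m X) = c \<cdot>\<^sub>m f ?E' X"
        using e d T' X c by (simp add: f lin_map_def) }
    fix Z :: "complex mat" assume Z: "Z \<in> carrier_mat dB dB"
    show "f ?E' (X + Z) = f ?E' X + f ?E' Z"
      using e d T' X Z c lin_map_carrier[OF e Z] by (simp add: f lin_map_def)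
  qed
  then show ?thesis
  proof (rule hs_adjoint_unique[symmetric, OF _ Y])
    note dY = hs_adjoint_carrier[OF d Y]
    show "comb_adjoint dA dB m Fe Fd E Y \<in> carrier_mat dB dB"
      using hs_adjoint_carrier[OF e] by (simp add: comb_adjoint_def comb_def)
    fix X :: "complex mat" assume X: "X \<in> carrier_mat dB dB"
    note eX = lin_map_carrier[OF e X]
    have "hs_inner (f ?E' X) Y =
        hs_inner (tensor_id dA dA m ?E' (Fe X)) (hs_adjoint (dA * m) dB Fd Y)"
      using hs_inner_hs_adjoint[OF d Y] by (simp add: f[OF X])
    also have "\<dots> = hs_inner (Fe X)
        (tensor_id dA dA m (hs_adjoint dA dA ?E') (hs_adjoint (dA * m) dB Fd Y))"
      by (rule hs_inner_tensor_id[OF E' eX dY])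
    also have "tensor_id dA dA m (hs_adjoint dA dA ?E') (hs_adjoint (dA * m) dB Fd Y) =
        tensor_id dA dA m E (hs_adjoint (dA * m) dB Fd Y)"
      by (simp add: tensor_id_def hs_adjoint_hs_adjoint[OF E])
    also have "hs_inner (Fe X) \<dots> = hs_inner X (comb_adjoint dA dB m Fe Fd E Y)"
      using hs_inner_hs_adjoint[OF e _ X] by (simp add: comb_adjoint_def comb_def)
    finally show "hs_inner (f ?E' X) Y = hs_inner X (comb_adjoint dA dB m Fe Fd E Y)" .
  qed
qed

lemma superchannel_adjoint_eq:
  assumes r: "realizes dA dB m Fe Fd f"
    and E: "lin_map dA dA E" and Y: "Y \<in> carrier_mat dB dB"
  shows "superchannel_adjoint dA dB f E Y = comb_adjoint dA dB m Fe Fd E Y"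
proof -
  have "\<exists>g m Fe Fd. realizes dA dB m Fe Fd f \<and> g = comb_adjoint dA dB m Fe Fd"
    using r by blast
  from someI_ex[OF this] obtain m' Fe' Fd' where r': "realizes dA dB m' Fe' Fd' f"
    and g: "superchannel_adjoint dA dB f = comb_adjoint dA dB m' Fe' Fd'"
    unfolding superchannel_adjoint_def by blast
  show ?thesis
    unfolding g comb_adjoint_eq[OF r' E Y] comb_adjoint_eq[OF r E Y] ..
qed

end

theory Submission
  imports Defs
begin

text \<open>
  Write \<open>E\<^sup>T = Ad_theta \<circ> E\<^sup>\<dagger> \<circ> Ad_theta\<close>; then \<open>f\<close> is T-symmetric iff \<open>f (C\<^sup>T) = (f C)\<^sup>T\<close> for
  all \<open>C\<close>.  Feed a uniformly random basis state \<open>k\<close> to the slot \<open>C\<close>, measure the output \<open>j\<close>, and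
  apply a channel chosen by the step from \<open>k\<close> to \<open>j\<close>: \<open>E\<close> for the step that the cyclic channel
  makes, \<open>E\<^sup>T\<close> for the reverse step, and the identity when \<open>j = k\<close>.  Transposing \<open>C\<close> swaps the
  weights of the two steps, hence the roles of \<open>E\<close> and \<open>E\<^sup>T\<close>.  Unitality of \<open>E\<close> makes \<open>E\<^sup>T\<close> trace
  preserving, and self-duality of the positive cone makes it completely positive.
\<close>

section \<open>Nonnegative forms\<close>

text \<open>Evaluating the form at \<open>e_a + c e_i\<close> isolates the 2 by 2 principal block at
  \<open>a\<close> and \<open>i\<close>; suitable choices of \<open>c\<close> then yield facts about
  single entries.\<close>

lemma hform_entry:
  fixes B :: "nat \<Rightarrow> nat \<Rightarrow> complex"
  assumes "finite S" "a \<in> S" "i \<in> S" "a \<noteq> i"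
  shows "(\<Sum>x\<in>S. \<Sum>y\<in>S. cnj ((\<lambda>t. if t = a then 1 else if t = i then c else 0) x) * B x y
            * (\<lambda>t. if t = a then 1 else if t = i then c else 0) y)
       = B a a + c * B a i + cnj c * B i a + cnj c * c * B i i"
proof -
  define v where "v = (\<lambda>t. if t = a then 1 else if t = i then c else (0::complex))"
  have "(\<Sum>x\<in>S. \<Sum>y\<in>S. cnj (v x) * B x y * v y) = (\<Sum>x\<in>{a,i}. \<Sum>y\<in>{a,i}. cnj (v x) * B x y * v y)"
    using assms by (intro sum.mono_neutral_cong_right) (auto simp: v_def intro!: sum.mono_neutral_right)
  also have "\<dots> = B a a + c * B a i + cnj c * B i a + cnj c * c * B i i"
    using assms by (simp add: v_def algebra_simps)
  finally show ?thesis unfolding v_def .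
qed

text \<open>A form with real values is Hermitian by polarisation. A zero diagonal entry kills its
  row, since otherwise the terms linear in \<open>c\<close> could be made to dominate with a
  negative sign.\<close>

lemma hform_nonneg_hermitian:
  fixes B :: "nat \<Rightarrow> nat \<Rightarrow> complex"
  assumes S: "finite S" and pos: "\<And>v. 0 \<le> (\<Sum>x\<in>S. \<Sum>y\<in>S. cnj (v x) * B x y * v y)"
    and i: "i \<in> S"
  shows "0 \<le> B i i" and "a \<in> S \<Longrightarrow> B i a = cnj (B a i)"
    and "a \<in> S \<Longrightarrow> B a a = 0 \<Longrightarrow> B a i = 0"
proof -
  have diag: "0 \<le> B a a" if "a \<in> S" for a
  proof -
    have "(\<Sum>x\<in>S. \<Sum>y\<in>S. cnj (of_bool (x = a)) * B x y * of_bool (y = a))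
        = (\<Sum>x\<in>{a}. \<Sum>y\<in>{a}. cnj (of_bool (x = a)) * B x y * of_bool (y = a))"
      using that S by (intro sum.mono_neutral_cong_right) (auto intro!: sum.mono_neutral_right)
    then show ?thesis using pos[of "\<lambda>x. of_bool (x = a)"] by simp
  qed
  show "0 \<le> B i i" using i by (rule diag)
  have q: "0 \<le> B a a + c * B a i + cnj c * B i a + cnj c * c * B i i" if "a \<in> S" "a \<noteq> i" for a c
    using pos[of "\<lambda>t. if t = a then 1 else if t = i then c else 0"] hform_entry[OF S that(1) i that(2)]
    by metis
  show herm: "B i a = cnj (B a i)" if a: "a \<in> S"
  proof (cases "a = i")
    case True
    then show ?thesis using diag[OF i] by (simp add: less_eq_complex_def complex_eq_iff)
  next
    case False
    \<comment> \<open>The imaginary part at \<open>c = 1\<close> compares the imaginary parts of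
      \<open>B a i\<close> and \<open>B i a\<close>; the one at \<open>c = \<i>\<close> compares
      their real parts.\<close>
    then show ?thesis
      using q[OF a False, of 1] q[OF a False, of \<i>] diag[OF i] diag[OF a]
      by (simp add: less_eq_complex_def complex_eq_iff)
  qed
  show "B a i = 0" if a: "a \<in> S" and 0: "B a a = 0"
  proof (rule ccontr)
    assume nz: "B a i \<noteq> 0"
    then have ne: "a \<noteq> i" using 0 by auto
    define b where "b = Re (B i i)"
    have b: "B i i = of_real b" "0 \<le> b"
      using diag[OF i] by (auto simp: less_eq_complex_def complex_eq_iff b_def)
    \<comment> \<open>At \<open>c = - t * cnj (B a i)\<close> the form takes the value
      \<open>t * N * (t * b - 2)\<close>. This \<open>t\<close> keeps \<open>t * b\<close> below 1,
      so the value is negative; the summand 1 covers \<open>b = 0\<close>.\<close>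
    define t where "t = 1 / (b + 1)"
    have t: "t > 0" "t * b < 1" using b by (auto simp: t_def field_simps)
    define N where "N = (cmod (B a i))\<^sup>2"
    have N: "N > 0" using nz by (simp add: N_def)
    have NN: "B a i * cnj (B a i) = of_real N" by (simp add: N_def complex_norm_square[symmetric])
    have "B a a + c * B a i + cnj c * B i a + cnj c * c * B i i
        = of_real (- 2 * t * N + t * t * b * N)" if "c = - of_real t * cnj (B a i)" for c
    proof -
      have "B a a + c * B a i + cnj c * B i a + cnj c * c * B i i
          = - 2 * of_real t * (B a i * cnj (B a i)) + of_real t * of_real t * (B a i * cnj (B a i)) * of_real b"
        using 0 by (simp add: that herm[OF a] b(1) algebra_simps)
      then show ?thesis unfolding NN by simp
    qed
    then have "0 \<le> - 2 * t * N + t * t * b * N"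
      using q[OF a ne, of "- of_real t * cnj (B a i)"] by (simp add: less_eq_complex_def)
    also have "\<dots> = t * N * (t * b - 2)" by (simp add: algebra_simps)
    also have "\<dots> < 0" using t N by (intro mult_pos_neg) auto
    finally show False by simp
  qed
qed

text \<open>Induction over the index set: the Schur complement of a diagonal entry of \<open>B\<close> is again
  nonnegative, and the rank-one form split off pairs nonnegatively with \<open>A\<close>.\<close>

lemma hform_pairing_nonneg:
  fixes A B :: "nat \<Rightarrow> nat \<Rightarrow> complex"
  assumes "finite S"
    and "\<And>v. 0 \<le> (\<Sum>x\<in>S. \<Sum>y\<in>S. cnj (v x) * A x y * v y)"
    and "\<And>v. 0 \<le> (\<Sum>x\<in>S. \<Sum>y\<in>S. cnj (v x) * B x y * v y)"
  shows "0 \<le> (\<Sum>x\<in>S. \<Sum>y\<in>S. cnj (A x y) * B x y)"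
  using assms
proof (induction S arbitrary: B rule: finite_induct)
  case empty
  then show ?case by simp
next
  case (insert a S)
  let ?S = "insert a S"
  have fin: "finite ?S" using insert.hyps by simp
  note B = hform_nonneg_hermitian[where B = B, OF fin insert.prems(2)]
  \<comment> \<open>The Schur complement. If \<open>B a a = 0\<close>, division by zero gives zero
    and \<open>B'\<close> is \<open>B\<close>, whose row and column \<open>a\<close> vanish already;
    so those of \<open>B'\<close> vanish in either case.\<close>
  define B' where "B' x y = B x y - B x a * B a y / B a a" for x y
  have Baa: "0 \<le> B a a" using B(1)[of a] by simp
  have herm: "B x a = cnj (B a x)" if "x \<in> ?S" for x using B(2)[of x a] that by simp
  have zero: "B a a = 0 \<Longrightarrow> B a x = 0" "B a a = 0 \<Longrightarrow> B x a = 0" if "x \<in> ?S" for x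
    using B(3)[of x a] herm[OF that] that by auto
  have B'a: "B' a x = 0" "B' x a = 0" if "x \<in> ?S" for x
    using zero[OF that] by (auto simp: B'_def)
  have cBaa: "cnj (B a a) = B a a" using herm[of a] by simp
  have "0 \<le> (\<Sum>x\<in>S. \<Sum>y\<in>S. cnj (v x) * B' x y * v y)" for v
  proof -
    define \<beta> where "\<beta> = (\<Sum>y\<in>S. B a y * v y)"
    \<comment> \<open>Completing the square: with this value at \<open>a\<close>, the form of
      \<open>B\<close> at \<open>u\<close> equals the form of \<open>B'\<close> at
      \<open>v\<close>.\<close>
    define u where "u = v(a := - \<beta> / B a a)"
    have c\<beta>: "(\<Sum>x\<in>S. cnj (v x) * B x a) = cnj \<beta>"
      unfolding \<beta>_def cnj_sum using herm by (intro sum.cong) auto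
    have uS: "u x = v x" if "x \<in> S" for x using that insert.hyps by (auto simp: u_def)
    have "(\<Sum>x\<in>?S. \<Sum>y\<in>?S. cnj (u x) * B x y * u y)
        = cnj (u a) * B a a * u a + cnj (u a) * (\<Sum>y\<in>S. B a y * u y)
          + (\<Sum>x\<in>S. cnj (u x) * B x a) * u a + (\<Sum>x\<in>S. \<Sum>y\<in>S. cnj (u x) * B x y * u y)"
      using insert.hyps by (simp add: sum.distrib sum_distrib_left sum_distrib_right mult.assoc)
    also have "\<dots> = cnj (u a) * B a a * u a + cnj (u a) * \<beta>
          + cnj \<beta> * u a + (\<Sum>x\<in>S. \<Sum>y\<in>S. cnj (v x) * B x y * v y)"
    proof -
      have "(\<Sum>y\<in>S. B a y * u y) = \<beta>" "(\<Sum>x\<in>S. cnj (u x) * B x a) = cnj \<beta>"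
        "(\<Sum>x\<in>S. \<Sum>y\<in>S. cnj (u x) * B x y * u y) = (\<Sum>x\<in>S. \<Sum>y\<in>S. cnj (v x) * B x y * v y)"
        unfolding c\<beta>[symmetric] unfolding \<beta>_def by (simp_all add: uS)
      then show ?thesis by simp
    qed
    also have "\<dots> = (\<Sum>x\<in>S. \<Sum>y\<in>S. cnj (v x) * B x y * v y) - cnj \<beta> * \<beta> / B a a"
    proof -
      have "u a = - \<beta> / B a a" "cnj (u a) = - cnj \<beta> / B a a" by (simp_all add: u_def cBaa)
      then show ?thesis by (cases "B a a = 0") simp_all
    qed
    also have "cnj \<beta> * \<beta> / B a a = (\<Sum>x\<in>S. \<Sum>y\<in>S. cnj (v x) * (B x a * B a y / B a a) * v y)"
    proof -
      have "cnj \<beta> * \<beta> / B a a = (\<Sum>x\<in>S. \<Sum>y\<in>S. cnj (v x) * B x a * (B a y * v y) / B a a)"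
        unfolding c\<beta>[symmetric] unfolding \<beta>_def sum_product sum_divide_distrib ..
      then show ?thesis by (simp add: mult.assoc)
    qed
    also have "(\<Sum>x\<in>S. \<Sum>y\<in>S. cnj (v x) * B x y * v y) - \<dots>
        = (\<Sum>x\<in>S. \<Sum>y\<in>S. cnj (v x) * B' x y * v y)"
      by (simp only: sum_subtractf[symmetric] B'_def) (simp only: left_diff_distrib right_diff_distrib)
    finally show ?thesis using insert.prems(2)[of u] by (simp only:)
  qed
  moreover have "0 \<le> (\<Sum>x\<in>S. \<Sum>y\<in>S. cnj (v x) * A x y * v y)" for v
  proof -
    have "(\<Sum>x\<in>?S. \<Sum>y\<in>?S. cnj ((v(a := 0)) x) * A x y * (v(a := 0)) y)
        = (\<Sum>x\<in>S. \<Sum>y\<in>S. cnj (v x) * A x y * v y)"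
      using insert.hyps by (auto intro!: sum.cong)
    then show ?thesis using insert.prems(1)[of "v(a := 0)"] by simp
  qed
  ultimately have IH: "0 \<le> (\<Sum>x\<in>S. \<Sum>y\<in>S. cnj (A x y) * B' x y)"
    by (intro insert.IH)
  have "(\<Sum>x\<in>?S. \<Sum>y\<in>?S. cnj (A x y) * B x y)
      = (\<Sum>x\<in>?S. \<Sum>y\<in>?S. cnj (A x y) * B' x y)
        + (\<Sum>x\<in>?S. \<Sum>y\<in>?S. cnj (A x y) * (B x a * B a y)) / B a a"
    by (simp only: sum.distrib[symmetric] sum_divide_distrib B'_def right_diff_distrib
        times_divide_eq_right diff_add_cancel)
  also have "(\<Sum>x\<in>?S. \<Sum>y\<in>?S. cnj (A x y) * B' x y) = (\<Sum>x\<in>S. \<Sum>y\<in>S. cnj (A x y) * B' x y)"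
    using insert.hyps B'a by simp
  \<comment> \<open>By Hermitian symmetry the rank-one part pairs with \<open>A\<close> as the
    conjugate of the form of \<open>A\<close> at column \<open>a\<close> of
    \<open>B\<close>.\<close>
  also have "(\<Sum>x\<in>?S. \<Sum>y\<in>?S. cnj (A x y) * (B x a * B a y))
      = cnj (\<Sum>x\<in>?S. \<Sum>y\<in>?S. cnj (B x a) * A x y * B y a)"
    unfolding cnj_sum using herm by (intro sum.cong refl) simp
  finally have eq: "(\<Sum>x\<in>?S. \<Sum>y\<in>?S. cnj (A x y) * B x y)
      = (\<Sum>x\<in>S. \<Sum>y\<in>S. cnj (A x y) * B' x y)
        + cnj (\<Sum>x\<in>?S. \<Sum>y\<in>?S. cnj (B x a) * A x y * B y a) / B a a" .
  have "0 \<le> cnj (\<Sum>x\<in>?S. \<Sum>y\<in>?S. cnj (B x a) * A x y * B y a) / B a a"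
    using insert.prems(1)[of "\<lambda>x. B x a"] Baa
    by (auto simp del: sum.insert cnj_sum simp: less_eq_complex_def Re_divide Im_divide)
  then show ?case unfolding eq using IH by (intro add_nonneg_nonneg)
qed

section \<open>Adjoints and transposes of completely positive maps\<close>

lemma qform_eq:
  assumes "X \<in> carrier_mat n n" "v \<in> carrier_vec n"
  shows "(X *\<^sub>v v) \<bullet>c v = (\<Sum>i<n. \<Sum>j<n. cnj (v $ i) * X $$ (i, j) * v $ j)"
proof -
  have "(X *\<^sub>v v) \<bullet>c v = (\<Sum>i<n. cnj (v $ i) * (\<Sum>j<n. X $$ (i, j) * v $ j))"
    using assms by (simp add: scalar_prod_def atLeast0LessThan conjugate_complex_def mult.commute)
  then show ?thesis by (simp add: sum_distrib_left mult.assoc)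
qed

text \<open>In the order on the complex numbers, \<open>0 \<le> z\<close> means that
  \<open>z\<close> is real and nonnegative, so one inequality replaces the two conditions. Functions
  as test vectors fit the lemmas on forms.\<close>

lemma psd_iff_form:
  "psd n X \<longleftrightarrow> X \<in> carrier_mat n n \<and>
     (\<forall>v. 0 \<le> (\<Sum>i<n. \<Sum>j<n. cnj (v i) * X $$ (i, j) * v j))"
proof (cases "X \<in> carrier_mat n n")
  case True
  have "(\<forall>v \<in> carrier_vec n. 0 \<le> (X *\<^sub>v v) \<bullet>c v) \<longleftrightarrow>
      (\<forall>v. 0 \<le> (\<Sum>i<n. \<Sum>j<n. cnj (v i) * X $$ (i, j) * v j))"
  proof (intro iffI allI ballI)
    fix v :: "nat \<Rightarrow> complex"
    assume "\<forall>v \<in> carrier_vec n. 0 \<le> (X *\<^sub>v v) \<bullet>c v"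
    then have "0 \<le> (X *\<^sub>v vec n v) \<bullet>c vec n v" by simp
    then show "0 \<le> (\<Sum>i<n. \<Sum>j<n. cnj (v i) * X $$ (i, j) * v j)"
      unfolding qform_eq[OF True vec_carrier] by simp
  qed (simp add: qform_eq[OF True])
  then show ?thesis using True by (auto simp: psd_def less_eq_complex_def)
qed (simp add: psd_def)

lemma psd_carrier: "psd n X \<Longrightarrow> X \<in> carrier_mat n n"
  by (simp add: psd_def)

lemma hs_inner_psd_nonneg:
  assumes "psd n A" "psd n B"
  shows "0 \<le> hs_inner A B"
  using assms hform_pairing_nonneg[of "{..<n}" "\<lambda>i j. A $$ (i, j)" "\<lambda>i j. B $$ (i, j)"]
  by (simp add: psd_iff_form hs_inner_sum[of _ n])

lemma psd_rank_one: "psd n (mat n n (\<lambda>(i, j). v i * cnj (v j)))"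
proof -
  have "0 \<le> (\<Sum>i<n. \<Sum>j<n. cnj (w i) * (v i * cnj (v j)) * w j)" for w
  proof -
    have "(\<Sum>i<n. \<Sum>j<n. cnj (w i) * (v i * cnj (v j)) * w j)
        = (\<Sum>i<n. cnj (w i) * v i) * cnj (\<Sum>i<n. cnj (w i) * v i)"
      unfolding cnj_sum sum_product by (intro sum.cong refl) simp
    then show ?thesis by (simp only: complex_mult_cnj) (simp add: less_eq_complex_def)
  qed
  then show ?thesis by (simp add: psd_iff_form)
qed

text \<open>Pairing with the rank-one matrix of \<open>v\<close> is the quadratic form at
  \<open>v\<close>, so these matrices suffice to detect positivity. This is the converse half of
  self-duality; \<open>hs_inner_psd_nonneg\<close> is the other.\<close>

lemma psd_iff_rank_one:
  "psd n X \<longleftrightarrow> X \<in> carrier_mat n n \<and>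
     (\<forall>v. 0 \<le> hs_inner (mat n n (\<lambda>(i, j). v i * cnj (v j))) X)"
proof -
  have "hs_inner (mat n n (\<lambda>(i, j). v i * cnj (v j))) X
      = (\<Sum>i<n. \<Sum>j<n. cnj (v i) * X $$ (i, j) * v j)" if "X \<in> carrier_mat n n" for v
    using that by (simp add: hs_inner_sum[of _ n] mult_ac)
  then show ?thesis by (cases "X \<in> carrier_mat n n") (simp_all only: psd_iff_form simp_thms)
qed

text \<open>Tensoring with the identity commutes with taking adjoints. A rank-one test matrix can
  therefore be moved across the pairing, where \<open>F\<close> keeps it positive, and self-duality
  applies on both sides.\<close>

lemma completely_positive_hs_adjoint:
  assumes F: "lin_map n n' F" "completely_positive n n' F"
  shows "completely_positive n' n (hs_adjoint n n' F)"
  unfolding completely_positive_def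
proof (intro allI impI)
  fix m Y assume Y: "psd (n' * m) Y"
  have "0 \<le> hs_inner (mat (n * m) (n * m) (\<lambda>(i, j). v i * cnj (v j)))
      (tensor_id n' n m (hs_adjoint n n' F) Y)" (is "0 \<le> hs_inner ?V _") for v
  proof -
    have "psd (n' * m) (tensor_id n n' m F ?V)"
      using F(2) psd_rank_one unfolding completely_positive_def by blast
    from hs_inner_psd_nonneg[OF this Y] show ?thesis
      by (subst hs_inner_tensor_id[OF F(1), symmetric]) (simp_all add: psd_carrier[OF Y])
  qed
  then show "psd (n * m) (tensor_id n' n m (hs_adjoint n n' F) Y)"
    unfolding psd_iff_rank_one by simp
qed

section \<open>Conjugation in the computational basis\<close>

lemma Ad_theta_carrier [simp]: "Ad_theta X \<in> carrier_mat n m \<longleftrightarrow> X \<in> carrier_mat n m"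
  by (simp add: Ad_theta_def)

lemma Ad_theta_dim [simp]: "dim_row (Ad_theta X) = dim_row X" "dim_col (Ad_theta X) = dim_col X"
  by (simp_all add: Ad_theta_def)

lemma Ad_theta_index [simp]:
  "i < dim_row X \<Longrightarrow> j < dim_col X \<Longrightarrow> Ad_theta X $$ (i, j) = cnj (X $$ (i, j))"
  by (simp add: Ad_theta_def)

lemma Ad_theta_Ad_theta [simp]: "Ad_theta (Ad_theta X) = X"
  by (intro eq_matI) auto

lemma Ad_theta_add:
  "X \<in> carrier_mat n m \<Longrightarrow> Y \<in> carrier_mat n m \<Longrightarrow> Ad_theta (X + Y) = Ad_theta X + Ad_theta Y"
  by (intro eq_matI) auto

lemma Ad_theta_smult: "Ad_theta (c \<cdot>\<^sub>m X) = cnj c \<cdot>\<^sub>m Ad_theta X"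
  by (intro eq_matI) auto

text \<open>The form of the conjugated matrix at \<open>v\<close> is the conjugate of the form of
  \<open>X\<close> at the conjugate of \<open>v\<close>, a nonnegative real.\<close>

lemma psd_Ad_theta: "psd n X \<Longrightarrow> psd n (Ad_theta X)"
proof -
  assume X: "psd n X"
  have "0 \<le> (\<Sum>i<n. \<Sum>j<n. cnj (v i) * Ad_theta X $$ (i, j) * v j)" for v
  proof -
    have "(\<Sum>i<n. \<Sum>j<n. cnj (v i) * Ad_theta X $$ (i, j) * v j)
        = cnj (\<Sum>i<n. \<Sum>j<n. cnj (cnj (v i)) * X $$ (i, j) * cnj (v j))"
      using psd_carrier[OF X] by simp
    moreover have "0 \<le> (\<Sum>i<n. \<Sum>j<n. cnj (cnj (v i)) * X $$ (i, j) * cnj (v j))"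
      using X[unfolded psd_iff_form, THEN conjunct2, THEN spec, of "\<lambda>i. cnj (v i)"] .
    ultimately show ?thesis by (simp add: less_eq_complex_def del: cnj_sum)
  qed
  then show ?thesis using psd_carrier[OF X] by (simp add: psd_iff_form)
qed

lemma lin_map_Ad_theta_conj:
  assumes "lin_map n n' F"
  shows "lin_map n n' (Ad_theta \<circ> F \<circ> Ad_theta)"
  using assms by (simp add: lin_map_def Ad_theta_add[of _ n n] Ad_theta_add[of _ n' n'] Ad_theta_smult)

text \<open>Conjugation acts entrywise, so it commutes with taking blocks and may be applied to the
  whole tensor product, where it preserves positivity.\<close>

lemma tensor_id_Ad_theta_conj:
  assumes F: "lin_map n n' F" and X: "X \<in> carrier_mat (n * m) (n * m)"
  shows "tensor_id n n' m (Ad_theta \<circ> F \<circ> Ad_theta) X = Ad_theta (tensor_id n n' m F (Ad_theta X))"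
proof (rule eq_matI)
  fix r s
  assume "r < dim_row (Ad_theta (tensor_id n n' m F (Ad_theta X)))"
    "s < dim_col (Ad_theta (tensor_id n n' m F (Ad_theta X)))"
  then have rs: "r < n' * m" "s < n' * m" by (simp_all add: tensor_id_def)
  have b: "Ad_theta (mblock n m (r mod m) (s mod m) X) = mblock n m (r mod m) (s mod m) (Ad_theta X)"
    using X rs by (intro eq_matI) (auto simp: mblock_def tensor_index_less tensor_mod_less)
  have "F (mblock n m (r mod m) (s mod m) (Ad_theta X)) \<in> carrier_mat n' n'"
    using F by (simp add: lin_map_def)
  then show "tensor_id n n' m (Ad_theta \<circ> F \<circ> Ad_theta) X $$ (r, s) =
      Ad_theta (tensor_id n n' m F (Ad_theta X)) $$ (r, s)"
    using rs by (simp add: tensor_id_def b tensor_div_less)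
qed (simp_all add: tensor_id_def)

lemma completely_positive_Ad_theta_conj:
  assumes "lin_map n n' F" "completely_positive n n' F"
  shows "completely_positive n n' (Ad_theta \<circ> F \<circ> Ad_theta)"
  unfolding completely_positive_def
proof (intro allI impI)
  fix m X assume X: "psd (n * m) X"
  have "psd (n' * m) (tensor_id n n' m F (Ad_theta X))"
    using assms(2) psd_Ad_theta[OF X] unfolding completely_positive_def by blast
  then show "psd (n' * m) (tensor_id n n' m (Ad_theta \<circ> F \<circ> Ad_theta) X)"
    unfolding tensor_id_Ad_theta_conj[OF assms(1) psd_carrier[OF X]] by (rule psd_Ad_theta)
qed

text \<open>In the basis of matrix units this is the plain transpose of the matrix of
  \<open>F\<close>: the two conjugations undo the one contained in the adjoint.\<close>

definition transpose_map where
  "transpose_map n F = Ad_theta \<circ> hs_adjoint n n F \<circ> Ad_theta"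

text \<open>A relation saying that \<open>G\<close> acts as the transpose of \<open>F\<close>. In
  this form it can be read in both directions and also covers the identity paired with
  itself.\<close>

definition transpose_pair where
  "transpose_pair n F G \<longleftrightarrow> (\<forall>W \<in> carrier_mat n n. \<forall>X \<in> carrier_mat n n.
     hs_inner (F W) (Ad_theta X) = hs_inner W (Ad_theta (G X)))"

text \<open>Both sides conjugate both arguments, which makes this pairing symmetric, whereas
  \<open>hs_inner\<close> is only Hermitian.\<close>

lemma hs_inner_Ad_theta_commute:
  "X \<in> carrier_mat n n \<Longrightarrow> Y \<in> carrier_mat n n \<Longrightarrow> hs_inner X (Ad_theta Y) = hs_inner Y (Ad_theta X)"
  by (simp add: hs_inner_sum[of _ n] mult.commute)

lemma transpose_pair_transpose_map:
  assumes "lin_map n n F"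
  shows "transpose_pair n F (transpose_map n F)"
  using hs_inner_hs_adjoint[OF assms] by (simp add: transpose_pair_def transpose_map_def)

lemma transpose_pair_sym:
  assumes "lin_map n n F" "lin_map n n G" "transpose_pair n F G"
  shows "transpose_pair n G F"
  unfolding transpose_pair_def
proof (intro ballI)
  fix W X :: "complex mat" assume WX: "W \<in> carrier_mat n n" "X \<in> carrier_mat n n"
  note c = lin_map_carrier[OF assms(1)] lin_map_carrier[OF assms(2)]
  have "hs_inner (G W) (Ad_theta X) = hs_inner X (Ad_theta (G W))"
    using WX c by (intro hs_inner_Ad_theta_commute)
  also have "\<dots> = hs_inner (F X) (Ad_theta W)"
    using assms(3) WX by (simp add: transpose_pair_def)
  also have "\<dots> = hs_inner W (Ad_theta (F X))"
    using WX c by (intro hs_inner_Ad_theta_commute)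
  finally show "hs_inner (G W) (Ad_theta X) = hs_inner W (Ad_theta (F X))" .
qed

lemma cptp_transpose_map:
  assumes "unital_channel n F"
  shows "cptp n n (transpose_map n F)"
proof -
  have F: "lin_map n n F" "completely_positive n n F" "F (1\<^sub>m n) = 1\<^sub>m n"
    using assms by (auto simp: unital_channel_def cptp_def)
  note F' = lin_map_hs_adjoint[OF F(1)] completely_positive_hs_adjoint[OF F(1,2)]
  have lin: "lin_map n n (transpose_map n F)"
    using lin_map_Ad_theta_conj[OF F'(1)] by (simp add: transpose_map_def)
  \<comment> \<open>Pairing with the identity reads off the conjugate of the trace, so moving
    \<open>F\<close> across the pairing turns unitality of \<open>F\<close> into trace preservation
    of its transpose.\<close>
  have one: "hs_inner (1\<^sub>m n) (Ad_theta X) = cnj (mtrace X)" if "X \<in> carrier_mat n n" for X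
  proof -
    have "hs_inner (1\<^sub>m n) (Ad_theta X) = (\<Sum>i<n. \<Sum>j<n. if i = j then cnj (X $$ (i, j)) else 0)"
      using that by (subst hs_inner_sum[of _ n]) (simp, simp, intro sum.cong refl, simp)
    then show ?thesis using that by (simp add: mtrace_def)
  qed
  have "mtrace (transpose_map n F X) = mtrace X" if "X \<in> carrier_mat n n" for X
  proof -
    have "hs_inner (F (1\<^sub>m n)) (Ad_theta X) = hs_inner (1\<^sub>m n) (Ad_theta (transpose_map n F X))"
      using transpose_pair_transpose_map[OF F(1)] that by (simp add: transpose_pair_def)
    then show ?thesis using that lin_map_carrier[OF lin that] by (simp add: F(3) one)
  qed
  then show ?thesis
    using lin completely_positive_Ad_theta_conj[OF F']
    by (simp add: cptp_def trace_preserving_def transpose_map_def)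
qed

section \<open>Coordinate maps and conic combinations\<close>

text \<open>The form of the new matrix at \<open>v\<close> is the form of \<open>X\<close> at the
  vector \<open>w\<close> that sums \<open>v\<close> over the fibres of \<open>g\<close> within
  \<open>p\<close>.\<close>

lemma psd_pullback:
  assumes X: "psd n X" and g: "\<And>r. r < n' \<Longrightarrow> p r \<Longrightarrow> g r < n"
  shows "psd n' (mat n' n' (\<lambda>(r, s). if p r \<and> p s then X $$ (g r, g s) else 0))"
proof -
  define R where "R = {r \<in> {..<n'}. p r}"
  have R: "finite R" "g ` R \<subseteq> {..<n}" using g by (auto simp: R_def)
  have group: "(\<Sum>i<n. (\<Sum>r | r \<in> R \<and> g r = i. c r) * h i) = (\<Sum>r\<in>R. c r * h (g r))"
    for c h :: "nat \<Rightarrow> complex"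
  proof -
    have "(\<Sum>i<n. (\<Sum>r | r \<in> R \<and> g r = i. c r) * h i)
        = (\<Sum>i<n. \<Sum>r | r \<in> R \<and> g r = i. c r * h (g r))"
      unfolding sum_distrib_right by (intro sum.cong refl) auto
    then show ?thesis using sum.group[OF R(1) _ R(2), of "\<lambda>r. c r * h (g r)"] by simp
  qed
  have "0 \<le> (\<Sum>r<n'. \<Sum>s<n'. cnj (v r) * (if p r \<and> p s then X $$ (g r, g s) else 0) * v s)" for v
  proof -
    define w where "w i = (\<Sum>r | r \<in> R \<and> g r = i. v r)" for i
    have "(\<Sum>i<n. \<Sum>j<n. cnj (w i) * X $$ (i, j) * w j)
        = (\<Sum>i<n. cnj (w i) * (\<Sum>j<n. w j * X $$ (i, j)))"
      by (simp add: sum_distrib_left mult_ac)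
    also have "\<dots> = (\<Sum>i<n. cnj (w i) * (\<Sum>s\<in>R. v s * X $$ (i, g s)))"
      unfolding w_def group ..
    also have "\<dots> = (\<Sum>r\<in>R. cnj (v r) * (\<Sum>s\<in>R. v s * X $$ (g r, g s)))"
      unfolding w_def cnj_sum group ..
    also have "\<dots> = (\<Sum>r\<in>R. \<Sum>s\<in>R. cnj (v r) * X $$ (g r, g s) * v s)"
      by (simp add: sum_distrib_left mult_ac)
    also have "\<dots> = (\<Sum>r<n'. \<Sum>s<n'. cnj (v r) * (if p r \<and> p s then X $$ (g r, g s) else 0) * v s)"
      unfolding R_def
      by (intro sum.mono_neutral_cong_left) (auto intro!: sum.mono_neutral_cong_left)
    finally show ?thesis
      using X[unfolded psd_iff_form, THEN conjunct2, THEN spec, of w] by (simp only:)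
  qed
  then show ?thesis by (simp add: psd_iff_form)
qed

lemma psd_conic:
  assumes M: "\<And>t. t \<in> T \<Longrightarrow> psd n (M t)" and w: "\<And>t. t \<in> T \<Longrightarrow> 0 \<le> w t"
  shows "psd n (mat n n (\<lambda>ij. \<Sum>t\<in>T. complex_of_real (w t) * M t $$ ij))"
proof -
  have "0 \<le> (\<Sum>i<n. \<Sum>j<n. cnj (v i) * (\<Sum>t\<in>T. complex_of_real (w t) * M t $$ (i, j)) * v j)" for v
  proof -
    have "(\<Sum>i<n. \<Sum>j<n. cnj (v i) * (\<Sum>t\<in>T. complex_of_real (w t) * M t $$ (i, j)) * v j)
        = (\<Sum>i<n. \<Sum>j<n. \<Sum>t\<in>T. complex_of_real (w t) * (cnj (v i) * M t $$ (i, j) * v j))"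
      by (simp add: sum_distrib_left sum_distrib_right mult_ac)
    also have "\<dots> = (\<Sum>i<n. \<Sum>t\<in>T. \<Sum>j<n. complex_of_real (w t) * (cnj (v i) * M t $$ (i, j) * v j))"
      by (intro sum.cong refl sum.swap)
    also have "\<dots> = (\<Sum>t\<in>T. \<Sum>i<n. \<Sum>j<n. complex_of_real (w t) * (cnj (v i) * M t $$ (i, j) * v j))"
      by (rule sum.swap)
    also have "\<dots> = (\<Sum>t\<in>T. complex_of_real (w t) * (\<Sum>i<n. \<Sum>j<n. cnj (v i) * M t $$ (i, j) * v j))"
      by (simp add: sum_distrib_left)
    also have "0 \<le> \<dots>"
    proof (rule sum_nonneg)
      fix t assume t: "t \<in> T"
      have "0 \<le> (\<Sum>i<n. \<Sum>j<n. cnj (v i) * M t $$ (i, j) * v j)"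
        using M[OF t] unfolding psd_iff_form by blast
      then show "0 \<le> complex_of_real (w t) * (\<Sum>i<n. \<Sum>j<n. cnj (v i) * M t $$ (i, j) * v j)"
        using w[OF t] by (intro mult_nonneg_nonneg) (simp_all add: less_eq_complex_def)
    qed
    finally show ?thesis .
  qed
  then show ?thesis by (simp add: psd_iff_form)
qed

text \<open>Conjugation by a single 0/1 Kraus operator, whose row \<open>r\<close> has its 1 in
  column \<open>g r\<close> if \<open>p r\<close> holds and is zero otherwise. It covers embeddings,
  compressions to a block and single classical transitions.\<close>

definition coord_map :: "nat \<Rightarrow> (nat \<Rightarrow> bool) \<Rightarrow> (nat \<Rightarrow> nat) \<Rightarrow> complex mat \<Rightarrow> complex mat" where
  "coord_map n p g X = mat n n (\<lambda>(r, s). if p r \<and> p s then X $$ (g r, g s) else 0)"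

lemma lin_map_coord_map:
  assumes "\<And>r. r < n' \<Longrightarrow> p r \<Longrightarrow> g r < n"
  shows "lin_map n n' (coord_map n' p g)"
  using assms by (auto simp: lin_map_def coord_map_def intro!: eq_matI)

lemma completely_positive_coord_map:
  assumes g: "\<And>r. r < n' \<Longrightarrow> p r \<Longrightarrow> g r < n"
  shows "completely_positive n n' (coord_map n' p g)"
  unfolding completely_positive_def
proof (intro allI impI)
  fix m X assume X: "psd (n * m) X"
  \<comment> \<open>Tensoring with the identity gives a pullback of the same kind, acting on the
    first component of each index pair.\<close>
  have "tensor_id n n' m (coord_map n' p g) X = mat (n' * m) (n' * m)
      (\<lambda>(r, s). if p (r div m) \<and> p (s div m)
        then X $$ (g (r div m) * m + r mod m, g (s div m) * m + s mod m) else 0)"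
    using g by (auto simp: tensor_id_def coord_map_def mblock_def tensor_div_less intro!: eq_matI)
  moreover have "psd (n' * m) \<dots>"
    by (rule psd_pullback[OF X]) (auto intro!: tensor_index_less g simp: tensor_div_less tensor_mod_less)
  ultimately show "psd (n' * m) (tensor_id n n' m (coord_map n' p g) X)" by simp
qed

text \<open>Serves both for random mixtures and, with unit weights, for sums over measurement
  outcomes. The index type is free because the decoder sums over pairs.\<close>

definition conic ::
    "nat \<Rightarrow> 't set \<Rightarrow> ('t \<Rightarrow> real) \<Rightarrow> ('t \<Rightarrow> complex mat \<Rightarrow> complex mat) \<Rightarrow> complex mat \<Rightarrow> complex mat" where
  "conic n T w F X = mat n n (\<lambda>ij. \<Sum>t\<in>T. complex_of_real (w t) * F t X $$ ij)"

lemma lin_map_conic: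
  assumes F: "\<And>t. t \<in> T \<Longrightarrow> lin_map n n' (F t)"
  shows "lin_map n n' (conic n' T w F)"
  unfolding lin_map_def
proof (intro conjI ballI allI)
  fix X :: "complex mat" assume X: "X \<in> carrier_mat n n"
  have FX: "F t X \<in> carrier_mat n' n'" if "t \<in> T" for t
    using lin_map_carrier[OF F[OF that] X] .
  show "conic n' T w F X \<in> carrier_mat n' n'" by (simp add: conic_def)
  show "conic n' T w F (c \<cdot>\<^sub>m X) = c \<cdot>\<^sub>m conic n' T w F X" for c
  proof (rule eq_matI)
    fix i j assume "i < dim_row (c \<cdot>\<^sub>m conic n' T w F X)" "j < dim_col (c \<cdot>\<^sub>m conic n' T w F X)"
    then have ij: "i < n'" "j < n'" by (simp_all add: conic_def)
    have "F t (c \<cdot>\<^sub>m X) $$ (i, j) = c * F t X $$ (i, j)" if "t \<in> T" for t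
      using F[OF that] X FX[OF that] ij by (auto simp: lin_map_def)
    then show "conic n' T w F (c \<cdot>\<^sub>m X) $$ (i, j) = (c \<cdot>\<^sub>m conic n' T w F X) $$ (i, j)"
      using ij by (simp add: conic_def sum_distrib_left mult.left_commute)
  qed (simp_all add: conic_def)
  fix Y :: "complex mat" assume Y: "Y \<in> carrier_mat n n"
  show "conic n' T w F (X + Y) = conic n' T w F X + conic n' T w F Y"
  proof (rule eq_matI)
    fix i j assume "i < dim_row (conic n' T w F X + conic n' T w F Y)"
      "j < dim_col (conic n' T w F X + conic n' T w F Y)"
    then have ij: "i < n'" "j < n'" by (simp_all add: conic_def)
    have "F t (X + Y) $$ (i, j) = F t X $$ (i, j) + F t Y $$ (i, j)" if "t \<in> T" for t
      using F[OF that] X Y FX[OF that] lin_map_carrier[OF F[OF that] Y] ij by (auto simp: lin_map_def)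
    then show "conic n' T w F (X + Y) $$ (i, j) = (conic n' T w F X + conic n' T w F Y) $$ (i, j)"
      using ij by (simp add: conic_def sum.distrib distrib_left)
  qed (simp_all add: conic_def)
qed

lemma completely_positive_conic:
  assumes F: "\<And>t. t \<in> T \<Longrightarrow> completely_positive n n' (F t)" and w: "\<And>t. t \<in> T \<Longrightarrow> 0 \<le> w t"
  shows "completely_positive n n' (conic n' T w F)"
  unfolding completely_positive_def
proof (intro allI impI)
  fix m X assume X: "psd (n * m) X"
  have "tensor_id n n' m (conic n' T w F) X = mat (n' * m) (n' * m)
      (\<lambda>ij. \<Sum>t\<in>T. complex_of_real (w t) * tensor_id n n' m (F t) X $$ ij)"
    by (intro eq_matI) (auto simp: tensor_id_def conic_def tensor_div_less)
  moreover have "psd (n' * m) (tensor_id n n' m (F t) X)" if "t \<in> T" for t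
    using F[OF that] X unfolding completely_positive_def by blast
  ultimately show "psd (n' * m) (tensor_id n n' m (conic n' T w F) X)"
    using psd_conic[where T = T and w = w, OF _ w] by simp
qed

lemma lin_map_comp: "lin_map n k G \<Longrightarrow> lin_map k l F \<Longrightarrow> lin_map n l (F \<circ> G)"
  by (auto simp: lin_map_def)

lemma completely_positive_comp:
  assumes "lin_map n k G" "completely_positive n k G" "completely_positive k l F"
  shows "completely_positive n l (F \<circ> G)"
  unfolding completely_positive_def
proof (intro allI impI)
  fix m X assume X: "psd (n * m) X"
  have "tensor_id n l m (F \<circ> G) X = tensor_id k l m F (tensor_id n k m G X)"
    by (intro eq_matI) (auto simp: tensor_id_def[of _ l] mblock_tensor_id[OF assms(1)] tensor_mod_less)
  moreover have "psd (l * m) (tensor_id k l m F (tensor_id n k m G X))"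
    using assms(2,3) X unfolding completely_positive_def by blast
  ultimately show "psd (l * m) (tensor_id n l m (F \<circ> G) X)" by simp
qed

lemma mtrace_conic:
  assumes "\<And>t. t \<in> T \<Longrightarrow> F t X \<in> carrier_mat n n"
  shows "mtrace (conic n T w F X) = (\<Sum>t\<in>T. complex_of_real (w t) * mtrace (F t X))"
proof -
  have "mtrace (conic n T w F X) = (\<Sum>t\<in>T. \<Sum>i<n. complex_of_real (w t) * F t X $$ (i, i))"
    by (simp add: mtrace_def conic_def) (rule sum.swap)
  also have "\<dots> = (\<Sum>t\<in>T. complex_of_real (w t) * mtrace (F t X))"
    using assms by (intro sum.cong refl) (auto simp: mtrace_def sum_distrib_left)
  finally show ?thesis .
qed

section \<open>The encoder, the decoder and the theorem\<close>

lemma lessThan_3: "{..<3} = {0, 1, 2 :: nat}"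
  by auto

lemma circlearrow_index:
  assumes "i < 3" "j < 3"
  shows "circlearrow X $$ (i, j) = (if i = j then X $$ ((j + 1) mod 3, (j + 1) mod 3) else 0)"
proof -
  have "i \<in> {0, 1, 2}" "j \<in> {0, 1, 2}" using assms by auto
  then show ?thesis
    by (auto simp: classical_channel_def cyclic_matrix_def mat_of_rows_list_def lessThan_3 numeral_2_eq_2)
qed

text \<open>Row \<open>t\<close> of the permutation matrix has its 1 in column \<open>t + 1\<close>
  modulo 3, so the Kraus operators are \<open>|t><t+1|\<close>. Linearity and complete positivity
  follow from this form.\<close>

lemma circlearrow_eq_conic:
  "circlearrow = conic 3 {..<3} (\<lambda>_. 1) (\<lambda>t. coord_map 3 (\<lambda>j. j = t) (\<lambda>j. (j + 1) mod 3))"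
proof
  fix X :: "complex mat"
  show "circlearrow X = conic 3 {..<3} (\<lambda>_. 1) (\<lambda>t. coord_map 3 (\<lambda>j. j = t) (\<lambda>j. (j + 1) mod 3)) X"
    (is "_ = ?R")
  proof (rule eq_matI)
    fix i j assume "i < dim_row ?R" "j < dim_col ?R"
    then have ij: "i < 3" "j < 3" by (simp_all add: conic_def)
    then have "i \<in> {0, 1, 2}" "j \<in> {0, 1, 2}" by auto
    then show "circlearrow X $$ (i, j) = ?R $$ (i, j)"
      unfolding circlearrow_index[OF ij] by (auto simp: conic_def coord_map_def lessThan_3)
  qed (simp_all add: classical_channel_def conic_def)
qed

lemma unital_channel_circlearrow: "unital_channel 3 circlearrow"
proof -
  have "lin_map 3 3 circlearrow"
    unfolding circlearrow_eq_conic by (intro lin_map_conic lin_map_coord_map) simp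
  moreover have "completely_positive 3 3 circlearrow"
    unfolding circlearrow_eq_conic
    by (intro completely_positive_conic completely_positive_coord_map) simp_all
  moreover have dim: "dim_row (circlearrow X) = 3" "dim_col (circlearrow X) = 3" for X
    by (simp_all add: classical_channel_def)
  have "trace_preserving 3 circlearrow"
    unfolding trace_preserving_def mtrace_def dim
    by (auto simp: lessThan_3 circlearrow_index numeral_2_eq_2)
  moreover have "circlearrow (1\<^sub>m 3) = 1\<^sub>m 3"
    by (intro eq_matI) (simp_all add: dim circlearrow_index)
  ultimately show ?thesis by (simp add: unital_channel_def cptp_def)
qed

text \<open>The memory holds the input and the label \<open>k\<close> of the basis state fed to the slot:
  \<open>|i\<rangle> \<otimes> |k\<rangle> \<otimes> |x\<rangle>\<close> has index \<open>(i * 3 + k) * d + x\<close>, and the encoder needs \<open>i = k\<close>.\<close>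

definition encoder :: "nat \<Rightarrow> complex mat \<Rightarrow> complex mat" where
  "encoder d = conic (3 * (3 * d)) {..<3} (\<lambda>_. 1 / 3)
     (\<lambda>k. coord_map (3 * (3 * d)) (\<lambda>r. r div d = k * 3 + k) (\<lambda>r. r mod d))"

text \<open>The block numbered \<open>j * 3 + k\<close> belongs to slot output \<open>j\<close> and
  memory label \<open>k\<close>. Compressing to the diagonal blocks measures both;
  \<open>ch j k\<close> then acts on the remaining factor.\<close>

definition decoder :: "nat \<Rightarrow> (nat \<Rightarrow> nat \<Rightarrow> complex mat \<Rightarrow> complex mat) \<Rightarrow> complex mat \<Rightarrow> complex mat" where
  "decoder d ch = conic d ({..<3} \<times> {..<3}) (\<lambda>_. 1)
     (\<lambda>(j, k). ch j k \<circ> coord_map d (\<lambda>_. True) (\<lambda>x. (j * 3 + k) * d + x))"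

lemma index_less: "x < d \<Longrightarrow> j < 3 \<Longrightarrow> k < 3 \<Longrightarrow> (j * 3 + k) * d + x < 9 * (d::nat)"
  using tensor_index_less[OF tensor_index_less[of j 3 k 3], of x d] by simp

lemma cptp_encoder:
  assumes d: "1 \<le> d"
  shows "cptp d (3 * (3 * d)) (encoder d)"
  unfolding cptp_def
proof (intro conjI)
  show "lin_map d (3 * (3 * d)) (encoder d)"
    unfolding encoder_def using d by (intro lin_map_conic lin_map_coord_map) simp
  show "completely_positive d (3 * (3 * d)) (encoder d)"
    unfolding encoder_def using d
    by (intro completely_positive_conic completely_positive_coord_map) simp_all
  show "trace_preserving d (encoder d)"
    unfolding trace_preserving_def
  proof
    fix X :: "complex mat" assume X: "X \<in> carrier_mat d d"
    \<comment> \<open>Each branch places \<open>X\<close> in a single diagonal block and so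
      preserves the trace; three branches of weight 1/3 average to the same trace.\<close>
    have "mtrace (coord_map (3 * (3 * d)) (\<lambda>r. r div d = k * 3 + k) (\<lambda>r. r mod d) X) = mtrace X"
      if k: "k < 3" for k
    proof -
      have "mtrace (coord_map (3 * (3 * d)) (\<lambda>r. r div d = k * 3 + k) (\<lambda>r. r mod d) X)
          = (\<Sum>r<9 * d. if r div d = k * 3 + k then X $$ (r mod d, r mod d) else 0)"
        by (simp add: mtrace_def coord_map_def)
      also have "\<dots> = (\<Sum>i<9. if i = k * 3 + k then \<Sum>x<d. X $$ (x, x) else 0)"
        unfolding sum_tensor_index using d by (intro sum.cong refl) simp
      also have "\<dots> = mtrace X" using k X by (simp add: mtrace_def)
      finally show ?thesis .
    qed
    then show "mtrace (encoder d X) = mtrace X"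
      unfolding encoder_def by (subst mtrace_conic) (simp_all add: coord_map_def)
  qed
qed

text \<open>The trace is preserved because the nine diagonal blocks exhaust the diagonal of the
  input and each passes through a trace preserving map.\<close>

lemma cptp_decoder:
  assumes ch: "\<And>j k. j < 3 \<Longrightarrow> k < 3 \<Longrightarrow> cptp d d (ch j k)"
  shows "cptp (3 * (3 * d)) d (decoder d ch)"
  unfolding cptp_def
proof (intro conjI)
  let ?b = "\<lambda>j k. coord_map d (\<lambda>_. True) (\<lambda>x. (j * 3 + k) * d + x)"
  have b: "lin_map (3 * (3 * d)) d (?b j k)" "completely_positive (3 * (3 * d)) d (?b j k)"
    if "j < 3" "k < 3" for j k
    using that by (simp_all add: lin_map_coord_map completely_positive_coord_map index_less)
  have lin: "lin_map (3 * (3 * d)) d (ch j k \<circ> ?b j k)" if "j < 3" "k < 3" for j k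
    using lin_map_comp[OF b(1)] ch that by (simp add: cptp_def)
  show "lin_map (3 * (3 * d)) d (decoder d ch)"
    unfolding decoder_def using lin by (intro lin_map_conic) auto
  have "completely_positive (3 * (3 * d)) d (ch j k \<circ> ?b j k)" if "j < 3" "k < 3" for j k
    using completely_positive_comp[OF b(1) b(2)] ch that by (simp add: cptp_def)
  then show "completely_positive (3 * (3 * d)) d (decoder d ch)"
    unfolding decoder_def by (intro completely_positive_conic) auto
  show "trace_preserving (3 * (3 * d)) (decoder d ch)"
    unfolding trace_preserving_def
  proof
    fix Y :: "complex mat" assume Y: "Y \<in> carrier_mat (3 * (3 * d)) (3 * (3 * d))"
    have "mtrace (decoder d ch Y) = (\<Sum>t\<in>{..<3} \<times> {..<3}. mtrace ((case t of (j, k) \<Rightarrow> ch j k \<circ> ?b j k) Y))"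
      unfolding decoder_def using lin_map_carrier[OF lin Y] by (subst mtrace_conic) auto
    also have "\<dots> = (\<Sum>j<3. \<Sum>k<3. mtrace (ch j k (?b j k Y)))"
      by (simp add: sum.cartesian_product case_prod_beta)
    also have "\<dots> = (\<Sum>j<3. \<Sum>k<3. mtrace (?b j k Y))"
      using ch lin_map_carrier[OF b(1) Y] by (intro sum.cong refl) (simp add: cptp_def trace_preserving_def)
    also have "\<dots> = (\<Sum>j<3. \<Sum>k<3. \<Sum>x<d. Y $$ ((j * 3 + k) * d + x, (j * 3 + k) * d + x))"
      by (simp add: mtrace_def coord_map_def)
    also have "\<dots> = (\<Sum>r<3 * 3 * d. Y $$ (r, r))" by (simp only: sum_tensor_index)
    also have "\<dots> = mtrace Y" using Y by (simp add: mtrace_def mult.assoc)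
    finally show "mtrace (decoder d ch Y) = mtrace Y" .
  qed
qed

text \<open>This is what the slot receives when the memory entries carry the same label
  \<open>k\<close>, the only entries that the decoder keeps.\<close>

lemma mblock_encoder:
  assumes x: "x < d" and y: "y < d" and k: "k < 3"
  shows "mblock 3 (3 * d) (k * d + x) (k * d + y) (encoder d X) = (X $$ (x, y) / 3) \<cdot>\<^sub>m mat_unit 3 k k"
proof (rule eq_matI)
  fix i j assume "i < dim_row ((X $$ (x, y) / 3) \<cdot>\<^sub>m mat_unit 3 k k)"
    "j < dim_col ((X $$ (x, y) / 3) \<cdot>\<^sub>m mat_unit 3 k k)"
  then have ij: "i < 3" "j < 3" by (simp_all add: mat_unit_def)
  \<comment> \<open>Reassociates the tensor factors: slot with (label, input) on the left, (slot,
    label) with input on the right.\<close>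
  have ix: "a * (3 * d) + (k * d + z) = (a * 3 + k) * d + z" for a z by (simp add: algebra_simps)
  have "encoder d X $$ ((i * 3 + k) * d + x, (j * 3 + k) * d + y)
      = (\<Sum>t<3. (if i * 3 + k = t * 3 + t \<and> j * 3 + k = t * 3 + t then X $$ (x, y) else 0) / 3)"
    using x y ij k by (auto simp: encoder_def conic_def coord_map_def index_less intro!: sum.cong)
  also have "\<dots> = (\<Sum>t<3. if t = k then (if i = k \<and> j = k then X $$ (x, y) / 3 else 0) else 0)"
  proof (intro sum.cong refl)
    fix t assume "t \<in> {..<3::nat}"
    then have t: "t < 3" by simp
    \<comment> \<open>Uniqueness of base 3 digits: the encoder occupies only indices whose two
      digits agree.\<close>
    have "a * 3 + k = t * 3 + t \<longleftrightarrow> a = t \<and> k = t" if "a < 3" for a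
    proof
      assume eq: "a * 3 + k = t * 3 + t"
      have "a = (a * 3 + k) div 3" using k by simp
      also have "\<dots> = t" unfolding eq using t by simp
      finally show "a = t \<and> k = t" using eq by simp
    qed simp
    from this[OF ij(1)] this[OF ij(2)] show "(if i * 3 + k = t * 3 + t \<and> j * 3 + k = t * 3 + t then X $$ (x, y) else 0) / 3
        = (if t = k then (if i = k \<and> j = k then X $$ (x, y) / 3 else 0) else 0)"
      by auto
  qed
  also have "\<dots> = (if i = k \<and> j = k then X $$ (x, y) / 3 else 0)" using k by simp
  finally show "mblock 3 (3 * d) (k * d + x) (k * d + y) (encoder d X) $$ (i, j) =
      ((X $$ (x, y) / 3) \<cdot>\<^sub>m mat_unit 3 k k) $$ (i, j)"
    using ij by (simp add: mblock_def mat_unit_def ix)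
qed (simp_all add: mblock_def mat_unit_def)

text \<open>The slot is fed basis states and only diagonal outputs are kept, so the comb depends on
  \<open>C\<close> just through the transition weights from \<open>k\<close> to \<open>j\<close>.
  Arbitrary linear \<open>C\<close> are covered, as T-symmetry demands.\<close>

lemma comb_encoder_decoder:
  assumes C: "lin_map 3 3 C" and X: "X \<in> carrier_mat d d"
    and ch: "\<And>j k. j < 3 \<Longrightarrow> k < 3 \<Longrightarrow> lin_map d d (ch j k)"
  shows "comb 3 (3 * d) (encoder d) (decoder d ch) C X =
    mat d d (\<lambda>ab. \<Sum>j<3. \<Sum>k<3. C (mat_unit 3 k k) $$ (j, j) / 3 * ch j k X $$ ab)"
proof -
  let ?Y = "tensor_id 3 3 (3 * d) C (encoder d X)"
  \<comment> \<open>Each block that the decoder extracts is a scalar multiple of the original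
    input.\<close>
  have b: "coord_map d (\<lambda>_. True) (\<lambda>x. (j * 3 + k) * d + x) ?Y
      = (C (mat_unit 3 k k) $$ (j, j) / 3) \<cdot>\<^sub>m X" if jk: "j < 3" "k < 3" for j k
  proof (rule eq_matI)
    fix x y assume "x < dim_row ((C (mat_unit 3 k k) $$ (j, j) / 3) \<cdot>\<^sub>m X)"
      "y < dim_col ((C (mat_unit 3 k k) $$ (j, j) / 3) \<cdot>\<^sub>m X)"
    then have xy: "x < d" "y < d" using X by auto
    have ix: "(j * 3 + k) * d + z = j * (3 * d) + (k * d + z)" for z by (simp add: algebra_simps)
    have dm: "((j * 3 + k) * d + z) div (3 * d) = j" "((j * 3 + k) * d + z) mod (3 * d) = k * d + z"
      if "z < d" for z
      using tensor_index_less[OF jk(2) that] that unfolding ix by simp_all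
    have "C (mat_unit 3 k k) \<in> carrier_mat 3 3" using C by (simp add: lin_map_def)
    moreover have "C ((X $$ (x, y) / 3) \<cdot>\<^sub>m mat_unit 3 k k) = (X $$ (x, y) / 3) \<cdot>\<^sub>m C (mat_unit 3 k k)"
      using C by (simp add: lin_map_def)
    ultimately show "coord_map d (\<lambda>_. True) (\<lambda>x. (j * 3 + k) * d + x) ?Y $$ (x, y)
        = ((C (mat_unit 3 k k) $$ (j, j) / 3) \<cdot>\<^sub>m X) $$ (x, y)"
      using xy X jk by (simp add: coord_map_def tensor_id_def index_less dm mblock_encoder)
  qed (use X in \<open>simp_all add: coord_map_def\<close>)
  have "ch j k (c \<cdot>\<^sub>m X) $$ (a, b) = c * ch j k X $$ (a, b)"
    if "j < 3" "k < 3" "a < d" "b < d" for j k a b c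
    using ch[OF that(1,2)] X that lin_map_carrier[OF ch[OF that(1,2)] X] by (auto simp: lin_map_def)
  moreover have "comb 3 (3 * d) (encoder d) (decoder d ch) C X = mat d d
      (\<lambda>ab. \<Sum>j<3. \<Sum>k<3. ch j k (coord_map d (\<lambda>_. True) (\<lambda>x. (j * 3 + k) * d + x) ?Y) $$ ab)"
    by (simp add: comb_def decoder_def conic_def sum.cartesian_product case_prod_beta)
  ultimately show ?thesis by (intro eq_matI) (simp_all add: b)
qed

lemma hs_inner_mixture:
  assumes F: "\<And>j k. j < m \<Longrightarrow> k < m \<Longrightarrow> F j k \<in> carrier_mat n n" and Y: "Y \<in> carrier_mat n n"
  shows "hs_inner (mat n n (\<lambda>ab. \<Sum>j<m. \<Sum>k<m. c j k * F j k $$ ab)) Y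
    = (\<Sum>j<m. \<Sum>k<(m::nat). cnj (c j k) * hs_inner (F j k) Y)"
proof -
  define h where "h a b j k = cnj (c j k) * (cnj (F j k $$ (a, b)) * Y $$ (a, b))" for a b j k
  have "hs_inner (mat n n (\<lambda>ab. \<Sum>j<m. \<Sum>k<m. c j k * F j k $$ ab)) Y
      = (\<Sum>a<n. \<Sum>b<n. \<Sum>j<m. \<Sum>k<m. h a b j k)"
    using Y by (simp add: hs_inner_sum[of _ n] h_def sum_distrib_right mult.assoc)
  also have "\<dots> = (\<Sum>a<n. \<Sum>j<m. \<Sum>b<n. \<Sum>k<m. h a b j k)"
    by (intro sum.cong refl sum.swap)
  also have "\<dots> = (\<Sum>j<m. \<Sum>a<n. \<Sum>b<n. \<Sum>k<m. h a b j k)" by (rule sum.swap)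
  also have "\<dots> = (\<Sum>j<m. \<Sum>a<n. \<Sum>k<m. \<Sum>b<n. h a b j k)"
    by (intro sum.cong refl sum.swap)
  also have "\<dots> = (\<Sum>j<m. \<Sum>k<m. \<Sum>a<n. \<Sum>b<n. h a b j k)"
    by (intro sum.cong refl sum.swap)
  also have "\<dots> = (\<Sum>j<m. \<Sum>k<m. cnj (c j k) * hs_inner (F j k) Y)"
    using F Y by (intro sum.cong refl) (simp add: hs_inner_sum[of _ n] h_def sum_distrib_left)
  finally show ?thesis .
qed

text \<open>Transposing \<open>C\<close> exchanges the weights of the steps from \<open>k\<close> to
  \<open>j\<close> and from \<open>j\<close> to \<open>k\<close>; transposing the result exchanges
  \<open>ch j k\<close> and \<open>ch k j\<close>. The two exchanges cancel in the sum.\<close>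

lemma T_symmetric_comb_encoder_decoder:
  assumes d: "1 \<le> d"
    and ch: "\<And>j k. j < 3 \<Longrightarrow> k < 3 \<Longrightarrow> cptp d d (ch j k)"
    and pair: "\<And>j k. j < 3 \<Longrightarrow> k < 3 \<Longrightarrow> transpose_pair d (ch j k) (ch k j)"
  shows "T_symmetric 3 d (comb 3 (3 * d) (encoder d) (decoder d ch))" (is "T_symmetric 3 d ?f")
proof -
  have r: "realizes 3 d (3 * d) (encoder d) (decoder d ch) ?f"
    using cptp_encoder[OF d] cptp_decoder[OF ch] by (simp add: realizes_def)
  have lin: "lin_map d d (ch j k)" if "j < 3" "k < 3" for j k
    using ch[OF that] by (rule cptp_linear)
  have f_eq: "?f C X = mat d d (\<lambda>ab. \<Sum>j<3. \<Sum>k<3. C (mat_unit 3 k k) $$ (j, j) / 3 * ch j k X $$ ab)"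
    if "lin_map 3 3 C" "X \<in> carrier_mat d d" for C X
    using comb_encoder_decoder[OF that, of ch] lin by blast
  have "?f C X = reverse_simulator 3 d ?f C X" if C: "lin_map 3 3 C" and X: "X \<in> carrier_mat d d" for C X
  proof -
    let ?C' = "Ad_theta \<circ> C \<circ> Ad_theta"
    have C': "lin_map 3 3 ?C'" by (rule lin_map_Ad_theta_conj[OF C])
    \<comment> \<open>\<open>D\<close> acts as the transpose of \<open>C\<close>. By
      \<open>comb_adjoint_eq\<close>, the adjoint supermap evaluated at \<open>?C'\<close> is the
      adjoint of \<open>?f D\<close>.\<close>
    define D where "D = hs_adjoint 3 3 ?C'"
    have D: "lin_map 3 3 D" unfolding D_def by (rule lin_map_hs_adjoint[OF C'])
    have entry: "D (mat_unit 3 k k) $$ (j, j) = C (mat_unit 3 j j) $$ (k, k)"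
      if jk: "j < 3" "k < 3" for j k
    proof -
      have u: "Ad_theta (mat_unit 3 j j) = mat_unit 3 j j"
        by (intro eq_matI) (auto simp: mat_unit_def)
      have c: "C (mat_unit 3 j j) \<in> carrier_mat 3 3" using C by (simp add: lin_map_def)
      have "D (mat_unit 3 k k) $$ (j, j) = hs_inner (mat_unit 3 j j) (D (mat_unit 3 k k))"
        using jk D by (simp add: hs_inner_mat_unit lin_map_def)
      also have "\<dots> = hs_inner (Ad_theta (C (mat_unit 3 j j))) (mat_unit 3 k k)"
        unfolding D_def by (subst hs_inner_hs_adjoint[OF C', symmetric]) (simp_all add: u)
      also have "\<dots> = cnj (hs_inner (mat_unit 3 k k) (Ad_theta (C (mat_unit 3 j j))))"
        using c by (intro hs_inner_cnj[of _ 3]) simp_all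
      also have "\<dots> = C (mat_unit 3 j j) $$ (k, k)"
        using c jk by (subst hs_inner_mat_unit[of _ 3]) auto
      finally show ?thesis .
    qed
    have fD: "lin_map d d (?f D)"
      using r lin_map_comp[OF lin_map_comp[OF _ lin_map_tensor_id[OF D]]]
      unfolding comb_def comp_assoc realizes_def by (blast intro: cptp_linear)
    have fC: "?f C X \<in> carrier_mat d d"
      by (simp add: f_eq[OF C X])
    \<comment> \<open>Equivalently, the transpose of \<open>?f D\<close> is \<open>?f C\<close>,
      which is the T-symmetry condition at \<open>C\<close>.\<close>
    have "hs_adjoint d d (?f D) (Ad_theta X) = Ad_theta (?f C X)"
    proof (rule hs_adjoint_unique[OF fD])
      fix W :: "complex mat" assume W: "W \<in> carrier_mat d d"
      note cW = lin_map_carrier[OF lin W] and cX = lin_map_carrier[OF lin X]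
      have "hs_inner (?f D W) (Ad_theta X)
          = (\<Sum>j<3. \<Sum>k<3. cnj (D (mat_unit 3 k k) $$ (j, j) / 3) * hs_inner (ch j k W) (Ad_theta X))"
        unfolding f_eq[OF D W] using cW X by (subst hs_inner_mixture) simp_all
      also have "\<dots> = (\<Sum>j<3. \<Sum>k<3. cnj (C (mat_unit 3 j j) $$ (k, k) / 3) * hs_inner (ch k j X) (Ad_theta W))"
      proof (intro sum.cong refl)
        fix j k :: nat assume "j \<in> {..<3}" "k \<in> {..<3}"
        then have jk: "j < 3" "k < 3" by auto
        have "hs_inner (ch j k W) (Ad_theta X) = hs_inner W (Ad_theta (ch k j X))"
          using pair[OF jk] W X by (simp add: transpose_pair_def)
        also have "\<dots> = hs_inner (ch k j X) (Ad_theta W)"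
          using W cX[OF jk(2,1)] by (rule hs_inner_Ad_theta_commute)
        finally show "cnj (D (mat_unit 3 k k) $$ (j, j) / 3) * hs_inner (ch j k W) (Ad_theta X)
            = cnj (C (mat_unit 3 j j) $$ (k, k) / 3) * hs_inner (ch k j X) (Ad_theta W)"
          by (simp add: entry[OF jk])
      qed
      also have "\<dots> = (\<Sum>j<3. \<Sum>k<3. cnj (C (mat_unit 3 k k) $$ (j, j) / 3) * hs_inner (ch j k X) (Ad_theta W))"
        by (rule sum.swap)
      also have "\<dots> = hs_inner (?f C X) (Ad_theta W)"
        unfolding f_eq[OF C X] using cX W by (subst hs_inner_mixture) simp_all
      also have "\<dots> = hs_inner W (Ad_theta (?f C X))"
        using fC W by (rule hs_inner_Ad_theta_commute)
      finally show "hs_inner (?f D W) (Ad_theta X) = hs_inner W (Ad_theta (?f C X))" .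
    qed (use X fC in simp_all)
    then show ?thesis
      using superchannel_adjoint_eq[OF r C', of "Ad_theta X"] comb_adjoint_eq[OF r C', of "Ad_theta X"] X
      by (simp add: reverse_simulator_def D_def)
  qed
  then show ?thesis using r unfolding T_symmetric_def superchannel_def by blast
qed

lemma cptp_id: "cptp n n (\<lambda>X. X)"
proof -
  have "tensor_id n n m (\<lambda>X. X) X = X" if "X \<in> carrier_mat (n * m) (n * m)" for m X
    using that by (intro eq_matI) (auto simp: tensor_id_def mblock_def tensor_div_less)
  then show ?thesis
    by (auto simp: cptp_def lin_map_def completely_positive_def trace_preserving_def psd_carrier)
qed

theorem mainTheorem3:
  shows "unital_channel 3 circlearrow \<and>
    (\<forall>d E. 1 \<le> d \<and> unital_channel d E \<longrightarrow>
      (\<exists>f. T_symmetric 3 d f \<and> (\<forall>X \<in> carrier_mat d d. f circlearrow X = E X)))"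
proof (intro conjI allI impI)
  show "unital_channel 3 circlearrow" by (rule unital_channel_circlearrow)
  fix d E assume "1 \<le> d \<and> unital_channel d E"
  then have d: "1 \<le> d" and E: "unital_channel d E" by auto
  then have E': "cptp d d E" "lin_map d d E" by (auto simp: unital_channel_def cptp_def)
  note T = cptp_transpose_map[OF E]
  \<comment> \<open>The cyclic channel moves \<open>k\<close> to \<open>(k + 2) mod 3\<close>, that
    is, one step down. The remaining off-diagonal case is the reverse step; the diagonal needs a
    channel that is its own transpose.\<close>
  define ch where "ch j k = (if j = k then (\<lambda>X. X) else if j = (k + 2) mod 3 then E else transpose_map d E)"
    for j k :: nat
  have ch: "cptp d d (ch j k)" for j k
    using E' T cptp_id by (simp add: ch_def)
  have pair: "transpose_pair d (ch j k) (ch k j)" if "j < 3" "k < 3" for j k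
  proof -
    have EE': "transpose_pair d E (transpose_map d E)"
      by (rule transpose_pair_transpose_map[OF E'(2)])
    note E'E = transpose_pair_sym[OF E'(2) cptp_linear[OF T] EE']
    have "j \<in> {0, 1, 2}" "k \<in> {0, 1, 2}" using that by auto
    \<comment> \<open>Of two distinct residues modulo 3 exactly one precedes the other, so
      \<open>ch j k\<close> and \<open>ch k j\<close> are \<open>E\<close> and its transpose in some
      order.\<close>
    then consider "j = k" | "j \<noteq> k" "j = (k + 2) mod 3" "k \<noteq> (j + 2) mod 3"
      | "j \<noteq> k" "j \<noteq> (k + 2) mod 3" "k = (j + 2) mod 3"
      by fastforce
    then show ?thesis
    proof cases
      case 1
      then show ?thesis by (simp add: ch_def transpose_pair_def)
    next
      case 2
      then have "ch j k = E" "ch k j = transpose_map d E" unfolding ch_def by metis+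
      then show ?thesis using EE' by simp
    next
      case 3
      then have "ch j k = transpose_map d E" "ch k j = E" unfolding ch_def by metis+
      then show ?thesis using E'E by simp
    qed
  qed
  let ?f = "comb 3 (3 * d) (encoder d) (decoder d ch)"
  have "?f circlearrow X = E X" if X: "X \<in> carrier_mat d d" for X
  proof -
    have C: "lin_map 3 3 circlearrow"
      using unital_channel_circlearrow by (simp add: unital_channel_def cptp_def)
    have c: "circlearrow (mat_unit 3 k k) $$ (j, j) = of_bool (j = (k + 2) mod 3)"
      if "j < 3" "k < 3" for j k
    proof -
      have "j \<in> {0, 1, 2}" "k \<in> {0, 1, 2}" using that by auto
      then show ?thesis
        unfolding circlearrow_index[OF that(1) that(1)]
        by (elim insertE emptyE) (simp_all add: mat_unit_def)
    qed
    \<comment> \<open>One \<open>j\<close> survives for each \<open>k\<close>, always with channel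
      \<open>E\<close> and weight 1/3, and the three terms add up to \<open>E X\<close>.\<close>
    have "(\<Sum>j<3. \<Sum>k<3. circlearrow (mat_unit 3 k k) $$ (j, j) / 3 * ch j k X $$ ab) = E X $$ ab" for ab
      by (simp add: lessThan_3 c ch_def)
    then show ?thesis
      unfolding comb_encoder_decoder[OF C X cptp_linear[OF ch]]
      using lin_map_carrier[OF E'(2) X] by (intro eq_matI) simp_all
  qed
  moreover have "T_symmetric 3 d ?f" using d ch pair by (rule T_symmetric_comb_encoder_decoder)
  ultimately show "\<exists>f. T_symmetric 3 d f \<and> (\<forall>X \<in> carrier_mat d d. f circlearrow X = E X)" by blast
qed

end
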